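(* Let $\mathcal{T}=(V,A,E,f,q,v_0)$ be a decorated pseudo-rooted tree and let $\mathscr{P}=\{X_1,\dots,X_n\}$ be a partition of $A\setminus A_0$. Then (a) $\delta(\mathcal{T})=\sum_{\alpha\in A\setminus A_0}\delta(\mathcal{T}_\alpha)-\sum_{\alpha\in A\setminus A_0}\mathfrak{D}(\mathcal{T},\{\alpha\})+\tfrac12 I(A\setminus A_0,A\setminus A_0)$; (b) $\delta(\mathcal{T})=\sum_{i=1}^n\delta(\mathcal{T}_{X_i})-\sum_{i=1}^n\mathfrak{D}(\mathcal{T},X_i)+\sum_{i<j}I(X_i,X_j)$; (c) $g(\mathcal{T})-1=\sum_{\alpha\in A\setminus A_0}(g(\mathcal{T}_\alpha)-1)-\sum_{\alpha\in A\setminus A_0}\mathfrak{G}(\mathcal{T},\{\alpha\})+\tfrac12 I(A\setminus A_0,A\setminus A_0)$; (d) $g(\mathcal{T})-1=\sum_{i=1}^n(g(\mathcal{T}_{X_i})-1)-\sum_{i=1}^n\mathfrak{G}(\mathcal{T},X_i)+\sum_{i<j}I(X_i,X_j)$.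
   Context: A graph is a pair $(X_0,X_1)$ of finite sets such that each element of $X_1$ (an edge) is a $2$-element subset of $X_0$; elements of $X_0$ are called cells. The valency $\delta_x$ of a cell $x$ is the number of edges containing $x$. A path is a tuple $(x_0,\dots,x_n)$ ($n\ge 0$) of cells such that $\{x_i,x_{i+1}\}$ is an edge for each $i<n$ and these edges are pairwise distinct; a cell (resp. edge) is in the path if it is one of the $x_i$ (resp. one of the $\{x_i,x_{i+1}\}$). The graph is a tree if for any cells $x,y$ there is a unique path from $x$ to $y$, denoted $\gamma_{x,y}$. A decorated tree is a $5$-tuple $(V,A,E,f,q)$ where $V$ (vertices) and $A$ (arrows) are finite disjoint sets, $(V\cup A,E)$ is a tree, every arrow has valency $1$, $f:A\to\mathbb{Z}$, $q$ assigns an integer $q(e,x)$ to each pair $(e,x)$ with $e\in E$, $x\in e$, such that $q(e,\alpha)=1$ whenever $\alpha\in A$, and for every $v\in V$ and distinct edges $e,e'$ containing $v$, $\gcd(q(e,v),q(e',v))=1$. Let $A_0=\{\alpha\in A: f(\alpha)=0\}$. For $x\in V\cup A$ and an edge $e\ni x$, $Q(e,x)=\prod q(e',x)$ over edges $e'\neq e$ containing $x$ (empty products equal $1$). An edge $\varepsilon$ is incident to a path $\gamma$ if $\varepsilon$ is not in $\gamma$ but contains some cell $u$ of $\gamma$; then $q(\varepsilon,\gamma):=q(\varepsilon,u)$. For $v\in V\cup A$, $\alpha\in A$, $v\ne\alpha$: $x_{v,\alpha}=f(\alpha)\prod_\varepsilon q(\varepsilon,\gamma_{v,\alpha})$ over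 edges $\varepsilon$ incident to $\gamma_{v,\alpha}$, and $\hat x_{v,\alpha}$ is the same with the product restricted to $\varepsilon$ not containing $v$. For $v\in V\cup A_0$, $N_v=\sum_{\alpha\in A\setminus A_0}x_{v,\alpha}$; $M(\mathcal{T})=-\sum_{v\in V\cup A_0}N_v(\delta_v-2)$. For $u\in V\cup A$ and an edge $e\ni u$, $p(u,e)=\sum\hat x_{u,\alpha}$ over $\alpha\in A\setminus A_0$ with $e$ in $\gamma_{u,\alpha}$. For $\alpha\in A\setminus A_0$ with unique edge $e_\alpha$, $F(\alpha)=\gcd(f(\alpha),p(\alpha,e_\alpha))\ge0$; $F(\mathcal{T})=\sum_{\alpha\in A\setminus A_0}F(\alpha)$. Genus $g(\mathcal{T})=\tfrac12(2-M(\mathcal{T})-F(\mathcal{T}))$, $\delta$-invariant $\delta(\mathcal{T})=\tfrac12(F(\mathcal{T})-M(\mathcal{T}))$. For a path $\gamma=(x_0,\dots,x_n)$, $n>0$, and a cell $u$ of $\gamma$, $Q(\gamma,u)=\prod q(\varepsilon,u)$ over edges $\varepsilon$ containing $u$ not in $\gamma$; $Q^*(\gamma)=\prod_{0<i<n}Q(\gamma,x_i)$. For $X,Y\subseteq A\setminus A_0$, $I(X,Y)=\sum_{(\alpha,\beta)\in X\times Y,\,\alpha\neq\beta}Q^*(\gamma_{\alpha,\beta})f(\alpha)f(\beta)$. For $X\subseteq A\setminus A_0$ and $X^c=(A\setminus A_0)\setminus X$: $\mathfrak{M}(\mathcal{T},X)=\sum_{\alpha\in X}(1-\tfrac1{f(\alpha)})I(\{\alpha\},X^c)$,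 $\mathfrak{D}(\mathcal{T},X)=\tfrac12\mathfrak{M}(\mathcal{T},X)-\tfrac12\sum_{\alpha\in X}(F(\alpha)-F_X(\alpha))$, $\mathfrak{G}(\mathcal{T},X)=\tfrac12\mathfrak{M}(\mathcal{T},X)+\tfrac12\sum_{\alpha\in X}(F(\alpha)-F_X(\alpha))$, where $F_X(\alpha)$ is $F(\alpha)$ computed in $\mathcal{T}_X$ (defined below). A pseudo-root of $(V,A,E,f,q)$ is a vertex $v_0$ with $q(e,v_0)=1$ for all edges $e\ni v_0$, such that for every $v\in V\setminus\{v_0\}$ at most one edge $e\ni v$ not in $\gamma_{v_0,v}$ has $q(e,v)\ne1$. A decorated pseudo-rooted tree is $(V,A,E,f,q,v_0)$ with $v_0$ a pseudo-root. For nonempty $X\subseteq A\setminus A_0$, $\mathcal{T}_X$: let $\mathcal{T}'_X$ have arrow set $X$, vertices those of $\mathcal{T}$ on some $\gamma_{v_0,\alpha}$ ($\alpha\in X$), edges those of $\mathcal{T}$ in some $\gamma_{v_0,\alpha}$ ($\alpha\in X$), decorations as in $\mathcal{T}$; for each vertex $v$ of $\mathcal{T}'_X$ put $b_v=\prod q(e,v)$ over edges $e$ of $\mathcal{T}$ containing $v$ not in $\mathcal{T}'_X$, and if $b_v\ne1$ add an arrow $\alpha_v$ with $f(\alpha_v)=0$ and edge $\{v,\alpha_v\}$ decorated $b_v$ near $v$, $1$ near $\alpha_v$. The result, pseudo-rooted at $v_0$, is $\mathcal{T}_X$; $\mathcal{T}_\alpha:=\mathcal{T}_{\{\alpha\}}$.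 Partitions consist of nonempty sets. *)

theory Defs
  imports Complex_Main
begin

text \<open>A decorated tree (V, A, E, f, q). Cells live in a type 'c; the decorations f and q are
total functions of which only the relevant values matter.\<close>

record 'c dtree =
  dverts :: "'c set"
  darrs  :: "'c set"
  dedges :: "'c set set"
  dfdec  :: "'c \<Rightarrow> int"
  dqdec  :: "'c set \<Rightarrow> 'c \<Rightarrow> int"

definition cells :: "('c, 'z) dtree_scheme \<Rightarrow> 'c set" where
  "cells T = dverts T \<union> darrs T"

definition is_graph :: "('c, 'z) dtree_scheme \<Rightarrow> bool" where
  "is_graph T \<longleftrightarrow> finite (dverts T) \<and> finite (darrs T) \<and> dverts T \<inter> darrs T = {} \<and>
     (\<forall>e\<in>dedges T. \<exists>x y. x \<noteq> y \<and> e = {x, y} \<and> x \<in> cells T \<and> y \<in> cells T)"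

definition valency :: "('c, 'z) dtree_scheme \<Rightarrow> 'c \<Rightarrow> nat" where
  "valency T x = card {e \<in> dedges T. x \<in> e}"

definition pedges_list :: "'c list \<Rightarrow> 'c set list" where
  "pedges_list xs = map (\<lambda>i. {xs ! i, xs ! Suc i}) [0..<length xs - 1]"

definition pedges :: "'c list \<Rightarrow> 'c set set" where
  "pedges xs = set (pedges_list xs)"

definition is_path :: "('c, 'z) dtree_scheme \<Rightarrow> 'c list \<Rightarrow> bool" where
  "is_path T xs \<longleftrightarrow> xs \<noteq> [] \<and> set xs \<subseteq> cells T \<and> pedges xs \<subseteq> dedges T
      \<and> distinct (pedges_list xs)"

definition is_tree :: "('c, 'z) dtree_scheme \<Rightarrow> bool" where
  "is_tree T \<longleftrightarrow> is_graph T \<and>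
     (\<forall>x\<in>cells T. \<forall>y\<in>cells T. \<exists>!xs. is_path T xs \<and> hd xs = x \<and> last xs = y)"

definition gam :: "('c, 'z) dtree_scheme \<Rightarrow> 'c \<Rightarrow> 'c \<Rightarrow> 'c list" where
  "gam T x y = (THE xs. is_path T xs \<and> hd xs = x \<and> last xs = y)"

definition decorated_tree :: "('c, 'z) dtree_scheme \<Rightarrow> bool" where
  "decorated_tree T \<longleftrightarrow> is_tree T \<and>
     (\<forall>a\<in>darrs T. valency T a = 1) \<and>
     (\<forall>e\<in>dedges T. \<forall>a\<in>darrs T. a \<in> e \<longrightarrow> dqdec T e a = 1) \<and>
     (\<forall>v\<in>dverts T. \<forall>e\<in>dedges T. \<forall>e'\<in>dedges T.
         v \<in> e \<and> v \<in> e' \<and> e \<noteq> e' \<longrightarrow> gcd (dqdec T e v) (dqdec T e' v) = 1)"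

definition arrs0 :: "('c, 'z) dtree_scheme \<Rightarrow> 'c set" where
  "arrs0 T = {a \<in> darrs T. dfdec T a = 0}"

definition arrsN :: "('c, 'z) dtree_scheme \<Rightarrow> 'c set" where
  "arrsN T = darrs T - arrs0 T"

definition incident :: "('c, 'z) dtree_scheme \<Rightarrow> 'c set \<Rightarrow> 'c list \<Rightarrow> bool" where
  "incident T \<epsilon> \<gamma> \<longleftrightarrow> \<epsilon> \<in> dedges T \<and> \<epsilon> \<notin> pedges \<gamma> \<and> (\<exists>u\<in>set \<gamma>. u \<in> \<epsilon>)"

definition qpath :: "('c, 'z) dtree_scheme \<Rightarrow> 'c set \<Rightarrow> 'c list \<Rightarrow> int" where
  "qpath T \<epsilon> \<gamma> = dqdec T \<epsilon> (THE u. u \<in> set \<gamma> \<and> u \<in> \<epsilon>)"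

definition xval :: "('c, 'z) dtree_scheme \<Rightarrow> 'c \<Rightarrow> 'c \<Rightarrow> int" where
  "xval T v a = dfdec T a * (\<Prod>\<epsilon>\<in>{\<epsilon>. incident T \<epsilon> (gam T v a)}. qpath T \<epsilon> (gam T v a))"

definition xhat :: "('c, 'z) dtree_scheme \<Rightarrow> 'c \<Rightarrow> 'c \<Rightarrow> int" where
  "xhat T v a = dfdec T a *
     (\<Prod>\<epsilon>\<in>{\<epsilon>. incident T \<epsilon> (gam T v a) \<and> v \<notin> \<epsilon>}. qpath T \<epsilon> (gam T v a))"

definition Nval :: "('c, 'z) dtree_scheme \<Rightarrow> 'c \<Rightarrow> int" where
  "Nval T v = (\<Sum>a\<in>arrsN T. xval T v a)"

definition Mval :: "('c, 'z) dtree_scheme \<Rightarrow> int" where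
  "Mval T = - (\<Sum>v\<in>dverts T \<union> arrs0 T. Nval T v * (int (valency T v) - 2))"

definition pval :: "('c, 'z) dtree_scheme \<Rightarrow> 'c \<Rightarrow> 'c set \<Rightarrow> int" where
  "pval T u e = (\<Sum>a\<in>{a \<in> arrsN T. e \<in> pedges (gam T u a)}. xhat T u a)"

definition arr_edge :: "('c, 'z) dtree_scheme \<Rightarrow> 'c \<Rightarrow> 'c set" where
  "arr_edge T a = (THE e. e \<in> dedges T \<and> a \<in> e)"

definition Fval :: "('c, 'z) dtree_scheme \<Rightarrow> 'c \<Rightarrow> int" where
  "Fval T a = gcd (dfdec T a) (pval T a (arr_edge T a))"

definition Ftot :: "('c, 'z) dtree_scheme \<Rightarrow> int" where
  "Ftot T = (\<Sum>a\<in>arrsN T. Fval T a)"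

definition genus :: "('c, 'z) dtree_scheme \<Rightarrow> real" where
  "genus T = (2 - of_int (Mval T) - of_int (Ftot T)) / 2"

definition delta_inv :: "('c, 'z) dtree_scheme \<Rightarrow> real" where
  "delta_inv T = (of_int (Ftot T) - of_int (Mval T)) / 2"

definition Qpath :: "('c, 'z) dtree_scheme \<Rightarrow> 'c list \<Rightarrow> 'c \<Rightarrow> int" where
  "Qpath T \<gamma> u = (\<Prod>\<epsilon>\<in>{\<epsilon> \<in> dedges T. u \<in> \<epsilon> \<and> \<epsilon> \<notin> pedges \<gamma>}. dqdec T \<epsilon> u)"

definition Qstar :: "('c, 'z) dtree_scheme \<Rightarrow> 'c list \<Rightarrow> int" where
  "Qstar T \<gamma> = (\<Prod>i\<in>{0<..<length \<gamma> - 1}. Qpath T \<gamma> (\<gamma> ! i))"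

definition Ival :: "('c, 'z) dtree_scheme \<Rightarrow> 'c set \<Rightarrow> 'c set \<Rightarrow> int" where
  "Ival T X Y = (\<Sum>(a, b)\<in>{(a, b). a \<in> X \<and> b \<in> Y \<and> a \<noteq> b}.
      Qstar T (gam T a b) * dfdec T a * dfdec T b)"

definition frakM :: "('c, 'z) dtree_scheme \<Rightarrow> 'c set \<Rightarrow> real" where
  "frakM T X = (\<Sum>a\<in>X. (1 - 1 / of_int (dfdec T a)) * of_int (Ival T {a} (arrsN T - X)))"

definition pseudo_root :: "('c, 'z) dtree_scheme \<Rightarrow> 'c \<Rightarrow> bool" where
  "pseudo_root T v0 \<longleftrightarrow> v0 \<in> dverts T \<and>
     (\<forall>e\<in>dedges T. v0 \<in> e \<longrightarrow> dqdec T e v0 = 1) \<and>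
     (\<forall>v\<in>dverts T - {v0}.
        card {e \<in> dedges T. v \<in> e \<and> e \<notin> pedges (gam T v0 v) \<and> dqdec T e v \<noteq> 1} \<le> 1)"

definition decorated_pr_tree :: "('c, 'z) dtree_scheme \<Rightarrow> 'c \<Rightarrow> bool" where
  "decorated_pr_tree T v0 \<longleftrightarrow> decorated_tree T \<and> pseudo_root T v0"

definition TXverts :: "('c, 'z) dtree_scheme \<Rightarrow> 'c \<Rightarrow> 'c set \<Rightarrow> 'c set" where
  "TXverts T v0 X = {v \<in> dverts T. \<exists>a\<in>X. v \<in> set (gam T v0 a)}"

definition TXedges :: "('c, 'z) dtree_scheme \<Rightarrow> 'c \<Rightarrow> 'c set \<Rightarrow> 'c set set" where
  "TXedges T v0 X = {e \<in> dedges T. \<exists>a\<in>X. e \<in> pedges (gam T v0 a)}"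

definition bval :: "('c, 'z) dtree_scheme \<Rightarrow> 'c \<Rightarrow> 'c set \<Rightarrow> 'c \<Rightarrow> int" where
  "bval T v0 X v = (\<Prod>e\<in>{e \<in> dedges T. v \<in> e \<and> e \<notin> TXedges T v0 X}. dqdec T e v)"

text \<open>T_X: old cells are tagged Inl; the new arrow alpha_v attached at v is Inr v.\<close>
definition TX :: "('c, 'z) dtree_scheme \<Rightarrow> 'c \<Rightarrow> 'c set \<Rightarrow> ('c + 'c) dtree" where
  "TX T v0 X = (let Vx = TXverts T v0 X; Bx = {v \<in> Vx. bval T v0 X v \<noteq> 1} in
     \<lparr> dverts = Inl ` Vx,
       darrs = Inl ` X \<union> Inr ` Bx,
       dedges = (\<lambda>e. Inl ` e) ` TXedges T v0 X \<union> (\<lambda>v. {Inl v, Inr v}) ` Bx,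
       dfdec = case_sum (dfdec T) (\<lambda>_. 0),
       dqdec = (\<lambda>e x. case x of
                   Inl c \<Rightarrow> (if Inr c \<in> e then bval T v0 X c else dqdec T (Inl -` e) c)
                 | Inr _ \<Rightarrow> 1) \<rparr>)"

definition FX :: "('c, 'z) dtree_scheme \<Rightarrow> 'c \<Rightarrow> 'c set \<Rightarrow> 'c \<Rightarrow> int" where
  "FX T v0 X a = Fval (TX T v0 X) (Inl a)"

definition frakD :: "('c, 'z) dtree_scheme \<Rightarrow> 'c \<Rightarrow> 'c set \<Rightarrow> real" where
  "frakD T v0 X = frakM T X / 2 - (\<Sum>a\<in>X. of_int (Fval T a - FX T v0 X a)) / 2"

definition frakG :: "('c, 'z) dtree_scheme \<Rightarrow> 'c \<Rightarrow> 'c set \<Rightarrow> real" where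
  "frakG T v0 X = frakM T X / 2 + (\<Sum>a\<in>X. of_int (Fval T a - FX T v0 X a)) / 2"

end

theory Submission
  imports Defs
begin

text \<open>
  All terms involving \<open>F\<close> cancel, so the four formulas reduce to one formula for \<open>M\<close>. Write
  \<open>x_{v,\<alpha>} = f(\<alpha>) y_v\<close> and root the tree at the arrow \<open>\<alpha>\<close>. Let \<open>z_v\<close> be \<open>y_v\<close> without the factors
  at \<open>v\<close> itself. Since at most one edge leading from \<open>v\<close> away from \<open>v0\<close> is decorated by a number other
  than 1, one gets \<open>y_v (\<delta>_v - 2) = (sum of z_w over the children w of v) - z_v\<close>, up to the error
  \<open>z_v (q - 1) (Q - 1)\<close> when \<open>v\<close> is an inner cell of the path from \<open>v0\<close> to \<open>\<alpha>\<close>; here \<open>q\<close> decorates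
  the edge at \<open>v\<close> towards \<open>v0\<close>, and \<open>Q\<close> is the product of the decorations at \<open>v\<close> off the path.
  The sum over all \<open>v \<noteq> \<alpha>\<close> telescopes to a number that depends only on the path from \<open>v0\<close> to \<open>\<alpha>\<close>
  and on \<open>q\<close>, \<open>Q\<close> along it, and these are the same in \<open>T\<close> and in \<open>T_X\<close>. Hence \<open>M(T)\<close> and the \<open>M(T_{X_i})\<close>
  differ only by the terms \<open>y_\<beta> (\<delta>_\<beta> - 2) = - Q^*(\<gamma>_{\<beta>,\<alpha>})\<close> for arrows \<open>\<beta>\<close> outside the part of \<open>\<alpha>\<close>.
\<close>

section \<open>Paths in trees\<close>

lemma pedges_list_simps [simp]:
  "pedges_list [] = []"
  "pedges_list [x] = []"
  "pedges_list (x # y # zs) = {x, y} # pedges_list (y # zs)"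
proof -
  have "[0..<Suc (length zs)] = 0 # map Suc [0..<length zs]"
    by (simp add: upt_conv_Cons map_Suc_upt del: upt_Suc)
  then show "pedges_list (x # y # zs) = {x, y} # pedges_list (y # zs)"
    unfolding pedges_list_def by (simp del: upt_Suc)
qed (simp_all add: pedges_list_def)

lemma pedges_simps [simp]:
  "pedges [] = {}"
  "pedges [x] = {}"
  "pedges (x # y # zs) = insert {x, y} (pedges (y # zs))"
  by (simp_all add: pedges_def)

lemma pedges_list_append:
  "pedges_list (xs @ y # ys) = pedges_list (xs @ [y]) @ pedges_list (y # ys)"
proof (induction xs)
  case (Cons x xs)
  then show ?case by (cases xs) auto
qed simp

lemma pedges_append: "pedges (xs @ y # ys) = pedges (xs @ [y]) \<union> pedges (y # ys)"
  unfolding pedges_def by (subst pedges_list_append) simp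

lemma pedges_list_rev: "pedges_list (rev xs) = rev (pedges_list xs)"
proof (induction xs)
  case (Cons x xs)
  show ?case
  proof (cases xs)
    case (Cons y ys)
    have "pedges_list (rev (x # xs)) = pedges_list (rev ys @ y # [x])"
      using Cons by simp
    also have "\<dots> = pedges_list (rev xs) @ [{x, y}]"
      using Cons by (subst pedges_list_append) (simp add: insert_commute)
    finally show ?thesis
      using Cons Cons.IH by simp
  qed simp
qed simp

lemma pedges_rev [simp]: "pedges (rev xs) = pedges xs"
  by (simp add: pedges_def pedges_list_rev)

lemma pedges_list_map: "pedges_list (map f xs) = map ((`) f) (pedges_list xs)"
proof (induction xs)
  case (Cons x xs)
  then show ?case by (cases xs) auto
qed simp

lemma pedges_map: "pedges (map f xs) = (`) f ` pedges xs"
  by (simp add: pedges_def pedges_list_map)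

lemma pedges_subset: "e \<in> pedges xs \<Longrightarrow> e \<subseteq> set xs"
proof (induction xs)
  case (Cons x xs)
  then show ?case by (cases xs) auto
qed simp

lemma set_in_pedges:
  "x \<in> set xs \<Longrightarrow> 2 \<le> length xs \<Longrightarrow> \<exists>e\<in>pedges xs. x \<in> e"
proof (induction xs)
  case (Cons a xs)
  show ?case
  proof (cases xs)
    case (Cons b ys)
    then show ?thesis using Cons.IH Cons.prems by (cases ys) auto
  qed (use Cons.prems in simp)
qed simp

lemma distinct_pedges_list: "distinct xs \<Longrightarrow> distinct (pedges_list xs)"
proof (induction xs)
  case (Cons x xs)
  show ?case
  proof (cases xs)
    case (Cons y ys)
    have "{x, y} \<notin> pedges xs"
      using pedges_subset[of "{x, y}" xs] Cons.prems by auto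
    then show ?thesis
      using Cons Cons.IH Cons.prems by (auto simp: pedges_def)
  qed simp
qed simp

text \<open>Loop erasure: when the new cell \<open>x\<close> already occurs in the shortened walk
  \<open>ys\<close>, everything of \<open>ys\<close> before it is dropped.\<close>

lemma walk_contains_distinct_walk:
  "xs \<noteq> [] \<Longrightarrow> \<exists>ys. ys \<noteq> [] \<and> distinct ys \<and> hd ys = hd xs \<and> last ys = last xs
     \<and> set ys \<subseteq> set xs \<and> pedges ys \<subseteq> pedges xs"
proof (induction xs)
  case (Cons x xs)
  show ?case
  proof (cases "xs = []")
    case True
    then show ?thesis by (intro exI[of _ "[x]"]) auto
  next
    case False
    then obtain ys where ys: "ys \<noteq> []" "distinct ys" "hd ys = hd xs" "last ys = last xs"
        "set ys \<subseteq> set xs" "pedges ys \<subseteq> pedges xs"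
      using Cons.IH by blast
    have sub: "pedges xs \<subseteq> pedges (x # xs)"
      using False by (cases xs) auto
    show ?thesis
    proof (cases "x \<in> set ys")
      case True
      then obtain p s where ps: "ys = p @ x # s"
        by (meson split_list)
      show ?thesis
        using ys ps False sub pedges_append[of p x s]
        by (intro exI[of _ "x # s"]) auto
    next
      case not_in: False
      have "pedges (x # ys) \<subseteq> pedges (x # xs)"
        using ys(1,3,6) False by (cases ys; cases xs) auto
      then show ?thesis
        using ys False not_in by (intro exI[of _ "x # ys"]) auto
    qed
  qed
qed simp

lemma graph_edgeE:
  assumes "is_graph T" "e \<in> dedges T"
  obtains x y where "x \<noteq> y" "e = {x, y}" "x \<in> cells T" "y \<in> cells T"
  using assms unfolding is_graph_def by blast

text \<open>Every cell of a walk with an edge is an end of one of its edges, hence lies in the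
  graph; a one-element list has no edges, and there the hypothesis on \<open>hd xs\<close> does the
  work.\<close>

lemma is_pathI:
  assumes "is_graph T" "xs \<noteq> []" "hd xs \<in> cells T" "pedges xs \<subseteq> dedges T" "distinct xs"
  shows "is_path T xs"
proof -
  have "set xs \<subseteq> cells T"
  proof (cases "2 \<le> length xs")
    case True
    show ?thesis
    proof
      fix x assume "x \<in> set xs"
      then obtain e where "e \<in> pedges xs" "x \<in> e"
        using set_in_pedges True by metis
      then show "x \<in> cells T"
        using assms(1,4) by (auto elim!: graph_edgeE)
    qed
  next
    case False
    then show ?thesis using assms(2,3) by (cases xs; cases "tl xs") auto
  qed
  then show ?thesis
    using assms unfolding is_path_def by (auto intro: distinct_pedges_list)
qed

lemma is_path_suffix: "is_path T (p @ x # s) \<Longrightarrow> is_path T (x # s)"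
  unfolding is_path_def
  using pedges_append[of p x s] pedges_list_append[of p x s] by auto

lemma is_path_prefix: "is_path T (p @ x # s) \<Longrightarrow> is_path T (p @ [x])"
  unfolding is_path_def
  using pedges_append[of p x s] pedges_list_append[of p x s] by auto

section \<open>Unique paths and the first step towards a given cell\<close>

locale path_tree =
  fixes T :: "('c, 'z) dtree_scheme"
  assumes tree: "is_tree T"
begin

lemma graph: "is_graph T"
  using tree by (simp add: is_tree_def)

lemma finite_cells: "finite (cells T)"
  using graph by (simp add: is_graph_def cells_def)

lemma finite_edges: "finite (dedges T)"
proof (rule finite_subset)
  show "dedges T \<subseteq> Pow (cells T)"
    using graph by (auto elim: graph_edgeE)
qed (simp add: finite_cells)

lemma edge_cells: "{x, y} \<in> dedges T \<Longrightarrow> x \<in> cells T \<and> y \<in> cells T \<and> x \<noteq> y"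
  using graph by (auto elim!: graph_edgeE simp: doubleton_eq_iff)

lemma edge_other:
  assumes "e \<in> dedges T" "x \<in> e"
  obtains y where "e = {x, y}" "y \<noteq> x" "y \<in> cells T"
proof -
  obtain a b where "a \<noteq> b" "e = {a, b}" "a \<in> cells T" "b \<in> cells T"
    using graph_edgeE[OF graph assms(1)] .
  then show ?thesis using assms(2) that[of a] that[of b] by (auto simp: insert_commute)
qed

lemma gam_ex1:
  "x \<in> cells T \<Longrightarrow> y \<in> cells T \<Longrightarrow> \<exists>!xs. is_path T xs \<and> hd xs = x \<and> last xs = y"
  using tree by (simp add: is_tree_def)

lemma gam_path:
  assumes "x \<in> cells T" "y \<in> cells T"
  shows "is_path T (gam T x y)" "hd (gam T x y) = x" "last (gam T x y) = y"
  using theI'[OF gam_ex1[OF assms]] unfolding gam_def by blast+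

lemma is_path_ends: "is_path T xs \<Longrightarrow> hd xs \<in> cells T \<and> last xs \<in> cells T"
  by (auto simp: is_path_def)

lemma gam_eq: "is_path T xs \<Longrightarrow> gam T (hd xs) (last xs) = xs"
  unfolding gam_def using is_path_ends[of xs] by (intro the1_equality gam_ex1) auto

lemma gam_eqI: "is_path T xs \<Longrightarrow> hd xs = x \<Longrightarrow> last xs = y \<Longrightarrow> gam T x y = xs"
  using gam_eq by blast

lemma gam_refl: "x \<in> cells T \<Longrightarrow> gam T x x = [x]"
  by (intro gam_eqI is_pathI graph) auto

text \<open>The definition of a path forbids only repeated edges. A repeated cell \<open>x\<close>
  would cut out a path of positive length from \<open>x\<close> to \<open>x\<close>, against
  uniqueness, since \<open>[x]\<close> is one already.\<close>

lemma is_path_distinct: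
  assumes "is_path T xs"
  shows "distinct xs"
proof (rule ccontr)
  assume "\<not> distinct xs"
  then obtain p q r x where xs: "xs = p @ [x] @ q @ [x] @ r"
    using not_distinct_decomp by blast
  have "is_path T (x # q @ x # r)"
    using assms xs is_path_suffix[of T p x] by simp
  then have *: "is_path T (x # q @ [x])"
    using is_path_prefix[of T "x # q" x r] by simp
  then have "x \<in> cells T"
    by (simp add: is_path_def)
  then show False
    using gam_eq[OF *] gam_refl[of x] by simp
qed

lemma gam_neq_Nil: "x \<in> cells T \<Longrightarrow> y \<in> cells T \<Longrightarrow> gam T x y \<noteq> []"
  using gam_path(1)[of x y] by (simp add: is_path_def)

lemma distinct_gam: "x \<in> cells T \<Longrightarrow> y \<in> cells T \<Longrightarrow> distinct (gam T x y)"
  by (simp add: gam_path(1) is_path_distinct)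

lemma gam_subset: "x \<in> cells T \<Longrightarrow> y \<in> cells T \<Longrightarrow> set (gam T x y) \<subseteq> cells T"
  using gam_path(1)[of x y] by (simp add: is_path_def)

lemma pedges_gam_subset: "x \<in> cells T \<Longrightarrow> y \<in> cells T \<Longrightarrow> pedges (gam T x y) \<subseteq> dedges T"
  using gam_path(1)[of x y] by (simp add: is_path_def)

lemma gam_ends: "x \<in> cells T \<Longrightarrow> y \<in> cells T \<Longrightarrow> x \<in> set (gam T x y) \<and> y \<in> set (gam T x y)"
  by (metis gam_neq_Nil gam_path(2,3) hd_in_set last_in_set)

lemma gam_rev:
  assumes "x \<in> cells T" "y \<in> cells T"
  shows "gam T y x = rev (gam T x y)"
proof (rule gam_eqI)
  show "is_path T (rev (gam T x y))"
    using gam_path(1)[OF assms] by (simp add: is_path_def pedges_list_rev)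
qed (use assms in \<open>simp_all add: hd_rev last_rev gam_path\<close>)

text \<open>Both parts of a path are paths, so uniqueness identifies them with
  \<open>gam T a x\<close> and \<open>gam T x b\<close>; \<open>tl\<close> drops the second copy of
  \<open>x\<close>.\<close>

lemma gam_split:
  assumes "a \<in> cells T" "b \<in> cells T" "x \<in> set (gam T a b)"
  shows "gam T a b = gam T a x @ tl (gam T x b)"
proof -
  obtain p s where ps: "gam T a b = p @ x # s"
    using assms(3) by (meson split_list)
  have path: "is_path T (p @ x # s)"
    using gam_path(1)[OF assms(1,2)] ps by simp
  have "gam T x b = x # s"
    using is_path_suffix[OF path] gam_path(3)[OF assms(1,2)] ps by (intro gam_eqI) auto
  moreover have "gam T a x = p @ [x]"
    using is_path_prefix[OF path] gam_path(2)[OF assms(1,2)] ps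
    by (intro gam_eqI) (auto simp: hd_append split: if_splits)
  ultimately show ?thesis
    using ps by simp
qed

lemma pedges_gam_split:
  assumes "a \<in> cells T" "b \<in> cells T" "x \<in> set (gam T a b)"
  shows "pedges (gam T a b) = pedges (gam T a x) \<union> pedges (gam T x b)"
proof -
  have x: "x \<in> cells T"
    using gam_subset[OF assms(1,2)] assms(3) by blast
  have 1: "gam T a x = butlast (gam T a x) @ [x]"
    using gam_neq_Nil[OF assms(1) x] gam_path(3)[OF assms(1) x] append_butlast_last_id by metis
  have 2: "gam T x b = x # tl (gam T x b)"
    using gam_neq_Nil[OF x assms(2)] gam_path(2)[OF x assms(2)] list.collapse by metis
  have "gam T a b = butlast (gam T a x) @ x # tl (gam T x b)"
    using gam_split[OF assms] 1 by (metis append.assoc append_Cons append_Nil)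
  then show ?thesis
    using pedges_append[of "butlast (gam T a x)" x "tl (gam T x b)"] 1 2 by metis
qed

text \<open>The parent of \<open>v\<close> in the tree rooted at \<open>a\<close>. For
  \<open>v = a\<close> the index 1 is out of range and the value is arbitrary, whence the side
  conditions \<open>v \<noteq> a\<close> and the disjunct \<open>v = a\<close> in the lemmas about
  it.\<close>

definition towards :: "'c \<Rightarrow> 'c \<Rightarrow> 'c" where
  "towards a v = gam T v a ! 1"

lemma gam_Cons:
  assumes "v \<in> cells T" "a \<in> cells T" "v \<noteq> a"
  shows "gam T v a = v # gam T (towards a v) a" "{v, towards a v} \<in> dedges T"
    "towards a v \<in> cells T" "v \<notin> set (gam T (towards a v) a)"
proof -
  obtain y s where g: "gam T v a = v # y # s"
    using assms gam_neq_Nil[OF assms(1,2)] gam_path(2,3)[OF assms(1,2)]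
    by (metis last_ConsL list.collapse)
  have path: "is_path T ([v] @ y # s)"
    using gam_path(1)[OF assms(1,2)] g by simp
  have y: "towards a v = y"
    by (simp add: towards_def g)
  have "gam T y a = y # s"
    using is_path_suffix[OF path] gam_path(3)[OF assms(1,2)] g by (intro gam_eqI) auto
  then show "gam T v a = v # gam T (towards a v) a" "v \<notin> set (gam T (towards a v) a)"
    using y g distinct_gam[OF assms(1,2)] by auto
  show "{v, towards a v} \<in> dedges T"
    using path y by (simp add: is_path_def)
  then show "towards a v \<in> cells T"
    using edge_cells by blast
qed

lemma gam_edge:
  assumes "{v, w} \<in> dedges T"
  shows "gam T v w = [v, w]"
  using edge_cells[OF assms] assms by (intro gam_eqI is_pathI graph) auto

text \<open>If \<open>w\<close> lay on the path from \<open>v\<close> to \<open>a\<close>, that path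
  would start with the edge from \<open>v\<close> to \<open>w\<close>, making \<open>w\<close> the
  parent of \<open>v\<close>. Hence \<open>w\<close> can be put in front of it.\<close>

lemma gam_step:
  assumes "{v, w} \<in> dedges T" "a \<in> cells T" "w \<noteq> towards a v \<or> v = a"
  shows "gam T w a = w # gam T v a"
proof -
  have c: "v \<in> cells T" "w \<in> cells T" "v \<noteq> w"
    using edge_cells[OF assms(1)] by auto
  have "w \<notin> set (gam T v a)"
  proof
    assume w: "w \<in> set (gam T v a)"
    show False
    proof (cases "v = a")
      case True
      then show False using w c by (simp add: gam_refl)
    next
      case False
      have "gam T v a = [v, w] @ tl (gam T w a)"
        using gam_split[OF c(1) assms(2) w] gam_edge[OF assms(1)] by simp
      then show False
        using False assms(3) by (simp add: towards_def)
    qed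
  qed
  moreover have "pedges (w # gam T v a) \<subseteq> dedges T"
    using pedges_gam_subset[OF c(1) assms(2)] gam_neq_Nil[OF c(1) assms(2)]
      gam_path(2)[OF c(1) assms(2)] assms(1)
    by (cases "gam T v a") (auto simp: insert_commute)
  ultimately have "is_path T (w # gam T v a)"
    using c distinct_gam[OF c(1) assms(2)] by (intro is_pathI graph) auto
  then show ?thesis
    using gam_path(3)[OF c(1) assms(2)] gam_neq_Nil[OF c(1) assms(2)] by (intro gam_eqI) auto
qed

lemma towards_step:
  assumes "{v, w} \<in> dedges T" "a \<in> cells T" "w \<noteq> towards a v \<or> v = a"
  shows "towards a w = v" "w \<noteq> a"
proof -
  have c: "v \<in> cells T" "w \<in> cells T" "v \<noteq> w"
    using edge_cells[OF assms(1)] by auto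
  show "towards a w = v"
    using gam_step[OF assms] gam_neq_Nil[OF c(1) assms(2)] gam_path(2)[OF c(1) assms(2)]
    by (simp add: towards_def hd_conv_nth)
  show "w \<noteq> a"
    using gam_step[OF assms] gam_neq_Nil[OF c(1) assms(2)] gam_refl[OF assms(2)] by auto
qed

lemma pedges_gam_Cons:
  assumes "v \<in> cells T" "a \<in> cells T" "v \<noteq> a"
  shows "pedges (gam T v a) = insert {v, towards a v} (pedges (gam T (towards a v) a))"
proof -
  have "gam T (towards a v) a = towards a v # tl (gam T (towards a v) a)"
    using gam_neq_Nil gam_path(2) gam_Cons(3)[OF assms] assms(2) list.collapse by metis
  then show ?thesis
    using gam_Cons(1)[OF assms] pedges_simps(3) by metis
qed

lemma first_edge_gam:
  assumes "v \<in> cells T" "a \<in> cells T" "v \<in> e"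
  shows "e \<in> pedges (gam T v a) \<longleftrightarrow> v \<noteq> a \<and> e = {v, towards a v}"
proof (cases "v = a")
  case True
  then show ?thesis by (simp add: gam_refl assms)
next
  case False
  have "e \<notin> pedges (gam T (towards a v) a)"
    using pedges_subset gam_Cons(4)[OF assms(1,2) False] assms(3) by blast
  then show ?thesis
    using pedges_gam_Cons[OF assms(1,2) False] False by auto
qed

text \<open>An edge is by uniqueness the whole path between its ends, so the stretch of
  \<open>g\<close> between \<open>u\<close> and \<open>u'\<close> has no inner cell. In particular
  an edge incident to a path meets it in just one cell, as the \<open>THE\<close> in
  \<open>qpath\<close> requires.\<close>

lemma no_chord:
  assumes "is_path T g" "u \<in> set g" "u' \<in> set g" "{u, u'} \<in> dedges T"
  shows "{u, u'} \<in> pedges g"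
proof -
  have ordered: "{x, y} \<in> pedges g"
    if e: "{x, y} \<in> dedges T" and g: "g = p @ x # q @ y # r" for x y p q r
  proof -
    have "is_path T (x # q @ y # r)"
      using assms(1) g is_path_suffix[of T p x] by simp
    then have *: "is_path T (x # q @ [y])"
      using is_path_prefix[of T "x # q" y r] by simp
    then have "x # q @ [y] = [x, y]"
      using gam_eq[OF *] gam_edge[OF e] by simp
    then have "q = []" by simp
    then show ?thesis using g pedges_append[of p x "y # r"] by auto
  qed
  obtain p s where ps: "g = p @ u # s"
    using assms(2) by (meson split_list)
  have "u \<noteq> u'" using edge_cells assms(4) by blast
  then consider "u' \<in> set s" | "u' \<in> set p"
    using assms(3) ps by auto
  then show ?thesis
  proof cases
    case 1
    then obtain q r where "s = q @ u' # r" by (meson split_list)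
    then show ?thesis using ordered assms(4) ps by blast
  next
    case 2
    then obtain q r where "p = q @ u' # r" by (meson split_list)
    then have "{u', u} \<in> pedges g"
      using ordered[of u' u q r s] assms(4) ps by (simp add: insert_commute)
    then show ?thesis by (simp add: insert_commute)
  qed
qed

text \<open>A path through \<open>v\<close> leaves it on its two sides by distinct cells.
  Conversely, branches from \<open>v\<close> with different first steps are disjoint and glue to a
  path, which is \<open>gam T a b\<close> by uniqueness.\<close>

lemma gam_through:
  assumes "a \<in> cells T" "b \<in> cells T" "v \<in> cells T" "v \<noteq> a" "v \<noteq> b"
  shows "v \<in> set (gam T a b) \<longleftrightarrow> towards a v \<noteq> towards b v"
proof
  assume v: "v \<in> set (gam T a b)"
  have "gam T a b = rev (gam T v a) @ tl (gam T v b)"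
    using gam_split[OF assms(1,2) v] gam_rev[OF assms(3,1)] by simp
  also have "tl (gam T v b) = gam T (towards b v) b"
    using gam_Cons(1)[OF assms(3,2,5)] by simp
  finally have "set (gam T v a) \<inter> set (gam T (towards b v) b) = {}"
    using distinct_gam[OF assms(1,2)] by auto
  moreover have "towards b v \<in> set (gam T (towards b v) b)"
    "towards a v \<in> set (gam T v a)"
    using gam_ends gam_Cons[OF assms(3,2,5)] gam_Cons[OF assms(3,1,4)] assms by auto
  ultimately show "towards a v \<noteq> towards b v" by auto
next
  assume ne: "towards a v \<noteq> towards b v"
  \<comment> \<open>All cells beyond \<open>v\<close> on the path to \<open>c\<close> lie in the
    same direction from \<open>v\<close>; a cell common to both branches would therefore identify
    their first steps.\<close>
  have first: "towards c v = towards x v" if "c \<in> cells T" "x \<in> set (gam T v c)" "x \<noteq> v" for c x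
  proof -
    have "x \<in> cells T" using gam_subset[OF assms(3) that(1)] that(2) by blast
    then have "gam T v x = v # gam T (towards x v) x" "towards x v \<in> cells T"
      using gam_Cons[OF assms(3) _ that(3)[symmetric]] by auto
    moreover have "gam T (towards x v) x = towards x v # tl (gam T (towards x v) x)"
      using gam_neq_Nil gam_path(2) calculation(2) \<open>x \<in> cells T\<close> list.collapse by metis
    ultimately have "gam T v x = v # towards x v # tl (gam T (towards x v) x)" by simp
    then have "gam T v c ! 1 = towards x v"
      using gam_split[OF assms(3) that(1,2)] by simp
    then show ?thesis by (simp add: towards_def)
  qed
  have disj: "set (gam T v a) \<inter> set (gam T (towards b v) b) = {}"
  proof (rule ccontr)
    assume "\<not> ?thesis"
    then obtain x where x: "x \<in> set (gam T v a)" "x \<in> set (gam T (towards b v) b)" by blast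
    then have "x \<noteq> v" "x \<in> set (gam T v b)"
      using gam_Cons[OF assms(3,2,5)] by auto
    then show False using first[OF assms(1) x(1)] first[OF assms(2)] ne by auto
  qed
  let ?g = "rev (gam T v a) @ gam T (towards b v) b"
  have eq: "?g = rev (gam T (towards a v) a) @ v # gam T (towards b v) b"
    using gam_Cons(1)[OF assms(3,1,4)] by simp
  have "pedges ?g = pedges (rev (gam T v a)) \<union> pedges (gam T v b)"
    using pedges_append[of "rev (gam T (towards a v) a)" v "gam T (towards b v) b"] eq
      gam_Cons(1)[OF assms(3,1,4)] gam_Cons(1)[OF assms(3,2,5)] by simp
  then have "pedges ?g \<subseteq> dedges T"
    using pedges_gam_subset assms by auto
  moreover have hd: "hd ?g = a"
    using gam_path(3)[OF assms(3,1)] gam_neq_Nil[OF assms(3,1)] by (simp add: hd_append hd_rev)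
  moreover have last: "last ?g = b"
    using gam_path(3) gam_neq_Nil gam_Cons(3)[OF assms(3,2,5)] assms(2) by auto
  moreover have "distinct ?g"
    using distinct_gam[OF assms(3,1)] distinct_gam[OF gam_Cons(3)[OF assms(3,2,5)] assms(2)] disj
    by auto
  ultimately have "gam T a b = ?g"
    using assms(1) gam_neq_Nil[OF assms(3,1)] by (intro gam_eqI is_pathI graph) auto
  then show "v \<in> set (gam T a b)"
    using gam_ends[OF assms(3,1)] by auto
qed

text \<open>Loop erasure of the walk gives a path with the same ends, and there is only one.\<close>

lemma gam_in_walk:
  assumes "xs \<noteq> []" "hd xs \<in> cells T" "pedges xs \<subseteq> dedges T"
  shows "pedges (gam T (hd xs) (last xs)) \<subseteq> pedges xs"
proof -
  obtain ys where "ys \<noteq> []" "distinct ys" "hd ys = hd xs" "last ys = last xs" "pedges ys \<subseteq> pedges xs"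
    using walk_contains_distinct_walk[OF assms(1)] by blast
  moreover then have "gam T (hd xs) (last xs) = ys"
    using assms by (intro gam_eqI is_pathI graph) auto
  ultimately show ?thesis by simp
qed

lemma pedges_gam_triangle:
  assumes "x \<in> cells T" "y \<in> cells T" "r \<in> cells T"
  shows "pedges (gam T x y) \<subseteq> pedges (gam T r x) \<union> pedges (gam T r y)"
proof -
  have r: "gam T r y = r # tl (gam T r y)"
    using gam_neq_Nil gam_path(2) assms list.collapse by metis
  have l: "gam T x r = butlast (gam T x r) @ [r]"
    using gam_neq_Nil gam_path(3) assms append_butlast_last_id by metis
  let ?w = "butlast (gam T x r) @ gam T r y"
  have "pedges ?w = pedges (gam T x r) \<union> pedges (gam T r y)"
    using pedges_append[of "butlast (gam T x r)" r "tl (gam T r y)"] l r by metis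
  moreover have "hd ?w = x"
    using l r gam_path(2)[OF assms(1,3)] by (metis hd_append list.sel(1))
  moreover have "last ?w = y"
    using gam_path(3)[OF assms(3,2)] gam_neq_Nil[OF assms(3,2)] by simp
  ultimately show ?thesis
    using gam_in_walk[of ?w] gam_neq_Nil[OF assms(3,2)] pedges_gam_subset assms
      gam_rev[OF assms(3,1)] by auto
qed

end

section \<open>Telescoping along a pseudo-rooted tree\<close>

text \<open>For \<open>g = gam T v a\<close> this is the number \<open>y_v\<close> of the
  introduction: the product of the decorations near \<open>g\<close> of all edges incident to it,
  grouped by the cells of \<open>g\<close>.\<close>

definition path_weight :: "('c, 'z) dtree_scheme \<Rightarrow> 'c list \<Rightarrow> int" where
  "path_weight T g = (\<Prod>u\<in>set g. Qpath T g u)"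

text \<open>For \<open>g = gam T v a\<close> this is \<open>z_v\<close>, the weight without the
  factors at the starting cell.\<close>

definition tail_weight :: "('c, 'z) dtree_scheme \<Rightarrow> 'c list \<Rightarrow> int" where
  "tail_weight T g = (\<Prod>u\<in>set g - {hd g}. Qpath T g u)"

lemma path_weight_eq_hd_tail:
  "g \<noteq> [] \<Longrightarrow> path_weight T g = Qpath T g (hd g) * tail_weight T g"
  unfolding path_weight_def tail_weight_def by (subst prod.remove[of _ "hd g"]) auto

lemma path_weight_rev [simp]: "path_weight T (rev g) = path_weight T g"
  by (simp add: path_weight_def Qpath_def)

text \<open>If \<open>s\<close> is the only index with \<open>q s \<noteq> 1\<close>, the summand
  omitting \<open>s\<close> is 1 and each of the other \<open>card K - 1\<close> summands is
  \<open>q s\<close>, the full product. With \<open>K\<close> the children of a cell,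
  \<open>card K - 1\<close> is the valency minus 2.\<close>

lemma sum_prod_remove_almost_one:
  fixes q :: "'a \<Rightarrow> int"
  assumes "finite K" and one: "\<And>w w'. w \<in> K \<Longrightarrow> w' \<in> K \<Longrightarrow> q w \<noteq> 1 \<Longrightarrow> q w' \<noteq> 1 \<Longrightarrow> w = w'"
  shows "(\<Sum>w\<in>K. \<Prod>w'\<in>K - {w}. q w') = (int (card K) - 1) * (\<Prod>w\<in>K. q w) + 1"
proof (cases "\<forall>w\<in>K. q w = 1")
  case True
  then show ?thesis by simp
next
  case False
  then obtain s where s: "s \<in> K" "q s \<noteq> 1" by blast
  define K' where "K' = K - {s}"
  have K: "K = insert s K'" "s \<notin> K'" "finite K'"
    using s assms(1) by (auto simp: K'_def)
  have q1: "q w = 1" if "w \<in> K'" for w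
    using one[of s w] s that by (auto simp: K'_def)
  have "(\<Prod>w'\<in>K - {w}. q w') = q s" if "w \<in> K'" for w
  proof -
    have "K - {w} = insert s (K' - {w})" using that K by auto
    then show ?thesis using K q1 by simp
  qed
  then have "(\<Sum>w\<in>K'. \<Prod>w'\<in>K - {w}. q w') = int (card K') * q s"
    by simp
  moreover have "(\<Prod>w'\<in>K - {s}. q w') = 1"
    using q1 by (simp add: K'_def)
  moreover have "(\<Prod>w\<in>K. q w) = q s"
    using K q1 by simp
  ultimately show ?thesis
    using K by (simp add: algebra_simps)
qed

context path_tree
begin

text \<open>Incident edges are grouped by the cell at which they meet the path; by
  \<open>no_chord\<close> these groups are disjoint.\<close>

lemma xval_eq:
  assumes "v \<in> cells T" "a \<in> cells T"
  shows "xval T v a = dfdec T a * path_weight T (gam T v a)"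
proof -
  let ?g = "gam T v a"
  let ?I = "\<lambda>u. {\<epsilon> \<in> dedges T. u \<in> \<epsilon> \<and> \<epsilon> \<notin> pedges ?g}"
  have uniq: "u = u'" if uu': "u \<in> set ?g" "u' \<in> set ?g" "\<epsilon> \<in> ?I u" "\<epsilon> \<in> ?I u'" for u u' \<epsilon>
  proof (rule ccontr)
    assume ne: "u \<noteq> u'"
    obtain y where "\<epsilon> = {u, y}"
      using edge_other[of \<epsilon> u] uu'(3) by blast
    then have "\<epsilon> = {u, u'}"
      using uu'(4) ne by auto
    then show False
      using no_chord[OF gam_path(1)[OF assms]] uu' by auto
  qed
  have "{\<epsilon>. incident T \<epsilon> ?g} = (\<Union>u\<in>set ?g. ?I u)"
    by (auto simp: incident_def)
  moreover have "\<forall>u\<in>set ?g. \<forall>u'\<in>set ?g. u \<noteq> u' \<longrightarrow> ?I u \<inter> ?I u' = {}"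
    using uniq by blast
  ultimately have "(\<Prod>\<epsilon>\<in>{\<epsilon>. incident T \<epsilon> ?g}. qpath T \<epsilon> ?g)
      = (\<Prod>u\<in>set ?g. \<Prod>\<epsilon>\<in>?I u. qpath T \<epsilon> ?g)"
    using finite_edges prod.UNION_disjoint[of "set ?g" ?I "\<lambda>\<epsilon>. qpath T \<epsilon> ?g"] by simp
  also have "\<dots> = (\<Prod>u\<in>set ?g. \<Prod>\<epsilon>\<in>?I u. dqdec T \<epsilon> u)"
  proof (intro prod.cong refl)
    fix u \<epsilon> assume *: "u \<in> set ?g" "\<epsilon> \<in> ?I u"
    have "(THE u. u \<in> set ?g \<and> u \<in> \<epsilon>) = u"
      using * uniq by (intro the_equality) auto
    then show "qpath T \<epsilon> ?g = dqdec T \<epsilon> u"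
      by (simp add: qpath_def)
  qed
  finally show ?thesis
    by (simp add: xval_def path_weight_def Qpath_def)
qed

text \<open>Children in the tree rooted at \<open>a\<close>; the root is excluded because
  \<open>towards a a\<close> is arbitrary.\<close>

definition children :: "'c \<Rightarrow> 'c \<Rightarrow> 'c set" where
  "children a v = {w \<in> cells T - {a}. towards a w = v}"

lemma finite_children: "finite (children a v)"
  by (simp add: children_def finite_cells)

lemma childrenD:
  assumes "w \<in> children a v" "a \<in> cells T"
  shows "w \<in> cells T" "w \<noteq> a" "{v, w} \<in> dedges T" "gam T w a = w # gam T v a"
    "w \<notin> set (gam T v a)" "v \<in> cells T"
  using assms gam_Cons[of w a] by (auto simp: children_def insert_commute)

lemma towards_notin_children:
  assumes "v \<in> cells T" "a \<in> cells T" "v \<noteq> a"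
  shows "towards a v \<notin> children a v"
proof
  assume "towards a v \<in> children a v"
  then have "towards a v \<notin> set (gam T v a)"
    using childrenD(5) assms(2) by blast
  moreover have "towards a v \<in> set (gam T v a)"
    using gam_Cons[OF assms] gam_ends[of "towards a v" a] assms(2) by auto
  ultimately show False by simp
qed

lemma edges_at:
  assumes "v \<in> cells T" "a \<in> cells T" "v \<noteq> a"
  shows "{e \<in> dedges T. v \<in> e} = insert {v, towards a v} ((\<lambda>w. {v, w}) ` children a v)"
proof (intro equalityI subsetI)
  fix e assume e: "e \<in> {e \<in> dedges T. v \<in> e}"
  then obtain w where w: "e = {v, w}" "{v, w} \<in> dedges T" "w \<in> cells T"
    using edge_other[of e v] by blast
  show "e \<in> insert {v, towards a v} ((\<lambda>w. {v, w}) ` children a v)"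
  proof (cases "w = towards a v")
    case False
    then have "w \<in> children a v"
      using towards_step[OF w(2) assms(2)] w(3) by (auto simp: children_def)
    then show ?thesis using w by auto
  qed (use w in auto)
next
  fix e assume "e \<in> insert {v, towards a v} ((\<lambda>w. {v, w}) ` children a v)"
  then show "e \<in> {e \<in> dedges T. v \<in> e}"
    using gam_Cons(2)[OF assms] childrenD(3)[OF _ assms(2)] by auto
qed

lemma inj_child_edge: "inj_on (\<lambda>w. {v, w}) K"
  by (auto simp: inj_on_def doubleton_eq_iff)

lemma valency_eq:
  assumes "v \<in> cells T" "a \<in> cells T" "v \<noteq> a"
  shows "valency T v = Suc (card (children a v))"
proof -
  have "{v, towards a v} \<notin> (\<lambda>w. {v, w}) ` children a v"
    using towards_notin_children[OF assms] by (auto simp: doubleton_eq_iff)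
  then show ?thesis
    unfolding valency_def edges_at[OF assms]
    by (simp add: finite_children card_image[OF inj_child_edge])
qed

lemma Qpath_start:
  assumes "v \<in> cells T" "a \<in> cells T" "v \<noteq> a"
  shows "Qpath T (gam T v a) v = (\<Prod>w\<in>children a v. dqdec T {v, w} v)"
proof -
  have "{\<epsilon> \<in> dedges T. v \<in> \<epsilon> \<and> \<epsilon> \<notin> pedges (gam T v a)} =
      {\<epsilon> \<in> dedges T. v \<in> \<epsilon>} - {{v, towards a v}}"
    using first_edge_gam[OF assms(1,2)] assms(3) by auto
  also have "\<dots> = (\<lambda>w. {v, w}) ` children a v"
    unfolding edges_at[OF assms]
    using towards_notin_children[OF assms] by (auto simp: doubleton_eq_iff)
  finally show ?thesis
    unfolding Qpath_def by (simp add: prod.reindex[OF inj_child_edge])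
qed

text \<open>Prepending \<open>w\<close> moves \<open>v\<close> from the head into the tail, where it
  contributes its decorations except those on the edges to \<open>w\<close> and to its parent. The
  other cells of the old path keep their factors because the new edge \<open>{v, w}\<close> does not
  contain them.\<close>

lemma tail_weight_child:
  assumes "v \<in> cells T" "a \<in> cells T" "v \<noteq> a" "w \<in> children a v"
  shows "tail_weight T (gam T w a) =
    tail_weight T (gam T v a) * (\<Prod>w'\<in>children a v - {w}. dqdec T {v, w'} v)"
proof -
  note w = childrenD[OF assms(4,2)]
  have v: "hd (gam T v a) = v" "v \<in> set (gam T v a)"
    using gam_path(2) gam_ends assms by auto
  have pe: "pedges (gam T w a) = insert {v, w} (pedges (gam T v a))"
    using w(4) v(1) gam_neq_Nil[OF assms(1,2)] by (cases "gam T v a") (auto simp: insert_commute)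
  have "{\<epsilon> \<in> dedges T. v \<in> \<epsilon> \<and> \<epsilon> \<notin> pedges (gam T w a)} =
      {\<epsilon> \<in> dedges T. v \<in> \<epsilon>} - {{v, towards a v}, {v, w}}"
    using first_edge_gam[OF assms(1,2)] assms(3) pe by auto
  also have "\<dots> = (\<lambda>w. {v, w}) ` (children a v - {w})"
    unfolding edges_at[OF assms(1-3)]
    using towards_notin_children[OF assms(1-3)] by (auto simp: doubleton_eq_iff)
  finally have qv: "Qpath T (gam T w a) v = (\<Prod>w'\<in>children a v - {w}. dqdec T {v, w'} v)"
    unfolding Qpath_def by (simp add: prod.reindex[OF inj_child_edge])
  have "tail_weight T (gam T w a) = (\<Prod>u\<in>set (gam T v a). Qpath T (gam T w a) u)"
    using w(4,5) by (simp add: tail_weight_def)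
  also have "\<dots> = Qpath T (gam T w a) v * (\<Prod>u\<in>set (gam T v a) - {v}. Qpath T (gam T w a) u)"
    using v by (subst prod.remove[of _ v]) auto
  also have "(\<Prod>u\<in>set (gam T v a) - {v}. Qpath T (gam T w a) u) = tail_weight T (gam T v a)"
    unfolding tail_weight_def v(1)
  proof (rule prod.cong[OF refl])
    fix u assume u: "u \<in> set (gam T v a) - {v}"
    then have "u \<noteq> v" "u \<noteq> w" using w(5) by auto
    then show "Qpath T (gam T w a) u = Qpath T (gam T v a) u"
      unfolding Qpath_def pe by (intro prod.cong) auto
  qed
  finally show ?thesis using qv by simp
qed

text \<open>Each cell other than \<open>a\<close> is the child of exactly one cell, so the double
  sum over all cells meets each \<open>h w\<close> once; the children of \<open>a\<close> itself are
  what the left side omits.\<close>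

lemma telescoping_children_sum:
  fixes h :: "'c \<Rightarrow> int"
  assumes "a \<in> cells T"
  shows "(\<Sum>v\<in>cells T - {a}. (\<Sum>w\<in>children a v. h w) - h v) = - (\<Sum>w\<in>children a a. h w)"
proof -
  have "(\<Sum>v\<in>cells T. \<Sum>w\<in>children a v. h w) = (\<Sum>w\<in>cells T - {a}. h w)"
    unfolding children_def
    using finite_cells gam_Cons(3)[OF _ assms] by (intro sum.group) auto
  moreover have "(\<Sum>v\<in>cells T. \<Sum>w\<in>children a v. h w) =
      (\<Sum>w\<in>children a a. h w) + (\<Sum>v\<in>cells T - {a}. \<Sum>w\<in>children a v. h w)"
    using assms finite_cells by (intro sum.remove) auto
  ultimately show ?thesis
    by (simp add: sum_subtractf)
qed

end

section \<open>Arrows, the pseudo-root, and the local balance at a cell\<close>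

locale pseudo_rooted_tree = path_tree T for T :: "('c, 'z) dtree_scheme" +
  fixes v0 :: 'c
  assumes arrow_valency: "a \<in> darrs T \<Longrightarrow> valency T a = 1"
    and root: "pseudo_root T v0"
begin

lemma root_vertex: "v0 \<in> dverts T" and root_cell: "v0 \<in> cells T"
  using root by (auto simp: pseudo_root_def cells_def)

lemma root_notin_arrows: "v0 \<notin> darrs T"
  using root_vertex graph by (auto simp: is_graph_def)

lemma arrow_cell: "a \<in> darrs T \<Longrightarrow> a \<in> cells T"
  by (simp add: cells_def)

text \<open>The single edge of an arrow already leads to its parent.\<close>

lemma arrow_children_empty:
  assumes "b \<in> darrs T" "a \<in> cells T" "a \<noteq> b"
  shows "children a b = {}"
  using valency_eq[of b a] arrow_valency[OF assms(1)] assms finite_children[of a b]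
  by (auto simp: cells_def)

lemma Qpath_arrow_end:
  assumes "b \<in> darrs T" "a \<in> cells T" "a \<noteq> b"
  shows "Qpath T (gam T b a) b = 1"
  using Qpath_start[of b a] arrow_children_empty[OF assms] assms by (simp add: arrow_cell)

text \<open>From an inner cell of a path two different edges lead to its ends, but an arrow has only
  one.\<close>

lemma arrow_inner:
  assumes "b \<in> darrs T" "x \<in> cells T" "y \<in> cells T" "b \<noteq> x" "b \<noteq> y"
  shows "b \<notin> set (gam T x y)"
proof
  assume "b \<in> set (gam T x y)"
  then have ne: "towards x b \<noteq> towards y b"
    using gam_through assms arrow_cell by metis
  have e: "{b, towards x b} \<in> dedges T"
    using gam_Cons(2) assms arrow_cell by blast
  have "towards x b \<in> children y b"
    using towards_step[OF e assms(3)] ne gam_Cons(3) assms arrow_cell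
    by (auto simp: children_def)
  then show False
    using arrow_children_empty[of b y] assms by auto
qed

text \<open>The pseudo-root condition concerns the edges at \<open>v\<close> other than the one
  towards \<open>v0\<close>. It is stated for vertices, and \<open>v\<close> is one because an arrow
  has no children.\<close>

lemma almost_one:
  assumes "v \<in> cells T" "v \<noteq> v0" "v \<noteq> a" "a \<in> cells T"
    and "w \<in> children a v - {towards v0 v}" "w' \<in> children a v - {towards v0 v}"
    and "dqdec T {v, w} v \<noteq> 1" "dqdec T {v, w'} v \<noteq> 1"
  shows "w = w'"
proof -
  have "v \<in> dverts T"
    using assms arrow_children_empty[of v a] by (auto simp: cells_def)
  let ?S = "{e \<in> dedges T. v \<in> e \<and> e \<notin> pedges (gam T v0 v) \<and> dqdec T e v \<noteq> 1}"
  have "card ?S \<le> 1"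
    using root \<open>v \<in> dverts T\<close> assms(2) by (auto simp: pseudo_root_def)
  moreover have "pedges (gam T v0 v) = pedges (gam T v v0)"
    using gam_rev[OF assms(1) root_cell] by simp
  then have "{v, x} \<in> ?S" if "x \<in> children a v - {towards v0 v}" "dqdec T {v, x} v \<noteq> 1" for x
    using that childrenD(3)[of x a v] assms(4) first_edge_gam[OF assms(1) root_cell, of "{v, x}"]
    by (auto simp: doubleton_eq_iff)
  then have "{v, w} \<in> ?S" "{v, w'} \<in> ?S"
    using assms(5-8) by blast+
  moreover have "finite ?S" using finite_edges by simp
  ultimately have "{v, w} = {v, w'}"
    using card_le_Suc0_iff_eq[of ?S] by simp
  then show ?thesis by (auto simp: doubleton_eq_iff)
qed

text \<open>Either the directions from \<open>v\<close> to \<open>a\<close> and to \<open>v0\<close>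
  coincide, or \<open>v = v0\<close> has only decorations 1. So among all children at most one is
  decorated by a number other than 1, and \<open>sum_prod_remove_almost_one\<close> gives the
  balance without error.\<close>

lemma balance_off_path:
  assumes "v \<in> cells T" "a \<in> cells T" "v \<noteq> a" "v = v0 \<or> v \<notin> set (gam T v0 a)"
  shows "path_weight T (gam T v a) * (int (valency T v) - 2) =
    (\<Sum>w\<in>children a v. tail_weight T (gam T w a)) - tail_weight T (gam T v a)"
proof -
  let ?q = "\<lambda>w. dqdec T {v, w} v" and ?K = "children a v" and ?z = "tail_weight T (gam T v a)"
  have one: "w = w'" if "w \<in> ?K" "w' \<in> ?K" "?q w \<noteq> 1" "?q w' \<noteq> 1" for w w'
  proof (cases "v = v0")
    case True
    then show ?thesis
      using root childrenD(3)[OF that(1) assms(2)] that(3) by (auto simp: pseudo_root_def)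
  next
    case False
    then have "towards v0 v = towards a v"
      using gam_through[OF root_cell assms(2,1) False assms(3)] assms(4) by blast
    then show ?thesis
      using almost_one[OF assms(1) False assms(3,2)] that
        towards_notin_children[OF assms(1-3)] by auto
  qed
  have "(\<Sum>w\<in>?K. tail_weight T (gam T w a)) = ?z * (\<Sum>w\<in>?K. \<Prod>w'\<in>?K - {w}. ?q w')"
    using tail_weight_child[OF assms(1-3)] by (simp add: sum_distrib_left)
  also have "\<dots> = ?z * ((int (card ?K) - 1) * (\<Prod>w\<in>?K. ?q w) + 1)"
    using one sum_prod_remove_almost_one[OF finite_children, of a v ?q] by simp
  finally show ?thesis
    using path_weight_eq_hd_tail[OF gam_neq_Nil[OF assms(1,2)], of T] gam_path(2)[OF assms(1,2)]
      Qpath_start[OF assms(1-3)] valency_eq[OF assms(1-3)]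
    by (simp add: algebra_simps)
qed

lemma Qpath_interior:
  assumes "v \<in> cells T" "a \<in> cells T" "v \<noteq> a" "v \<noteq> v0" "v \<in> set (gam T v0 a)"
  shows "Qpath T (gam T v0 a) v = (\<Prod>w\<in>children a v - {towards v0 v}. dqdec T {v, w} v)"
proof -
  have "pedges (gam T v0 a) = pedges (gam T v v0) \<union> pedges (gam T v a)"
    using pedges_gam_split[OF root_cell assms(2,5)] gam_rev[OF assms(1) root_cell] by simp
  then have "{\<epsilon> \<in> dedges T. v \<in> \<epsilon> \<and> \<epsilon> \<notin> pedges (gam T v0 a)} =
      {\<epsilon> \<in> dedges T. v \<in> \<epsilon>} - {{v, towards a v}, {v, towards v0 v}}"
    using first_edge_gam[OF assms(1,2)] first_edge_gam[OF assms(1) root_cell] assms(3,4) by auto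
  also have "\<dots> = (\<lambda>w. {v, w}) ` (children a v - {towards v0 v})"
    unfolding edges_at[OF assms(1-3)]
    using towards_notin_children[OF assms(1-3)] by (auto simp: doubleton_eq_iff)
  finally show ?thesis
    unfolding Qpath_def by (simp add: prod.reindex[OF inj_child_edge])
qed

text \<open>The error term \<open>z_v (q - 1) (Q - 1)\<close> of the introduction; the cell
  \<open>gam T v v0 ! 1\<close> is \<open>towards v0 v\<close>.\<close>

definition correction :: "'c \<Rightarrow> 'c \<Rightarrow> int" where
  "correction a v = tail_weight T (gam T v a) *
     (dqdec T {v, gam T v v0 ! 1} v - 1) * (Qpath T (gam T v0 a) v - 1)"

text \<open>The child \<open>w0\<close> towards \<open>v0\<close> escapes the pseudo-root condition
  and is split off. With \<open>q0\<close> its decoration and \<open>b\<close> the product over the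
  set \<open>K\<close> of the other children, both sides equal
  \<open>z_v * q0 * b * card K\<close>.\<close>

lemma balance_on_path:
  assumes "v \<in> cells T" "a \<in> cells T" "v \<noteq> a" "v \<noteq> v0" "v \<in> set (gam T v0 a)"
  shows "path_weight T (gam T v a) * (int (valency T v) - 2) =
    (\<Sum>w\<in>children a v. tail_weight T (gam T w a)) - tail_weight T (gam T v a) + correction a v"
proof -
  let ?q = "\<lambda>w. dqdec T {v, w} v" and ?z = "tail_weight T (gam T v a)"
  define w0 where "w0 = towards v0 v"
  define K where "K = children a v - {w0}"
  define b where "b = (\<Prod>w\<in>K. ?q w)"
  have "w0 \<in> children a v"
  proof -
    have "towards v0 v \<noteq> towards a v"
      using gam_through[OF root_cell assms(2,1,4,3)] assms(5) by blast
    then show ?thesis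
      using towards_step[OF gam_Cons(2)[OF assms(1) root_cell assms(4)] assms(2)]
        gam_Cons(3)[OF assms(1) root_cell assms(4)] by (auto simp: children_def w0_def)
  qed
  then have ch: "children a v = insert w0 K" "w0 \<notin> K" "finite K"
    using finite_children by (auto simp: K_def)
  have one: "w = w'" if "w \<in> K" "w' \<in> K" "?q w \<noteq> 1" "?q w' \<noteq> 1" for w w'
    using almost_one[OF assms(1,4,3,2)] that by (auto simp: K_def w0_def)
  have rem: "(\<Prod>w'\<in>children a v - {w}. ?q w') = ?q w0 * (\<Prod>w'\<in>K - {w}. ?q w')" if "w \<in> K" for w
  proof -
    have "children a v - {w} = insert w0 (K - {w})" using ch that by auto
    then show ?thesis using ch by simp
  qed
  have "(\<Sum>w\<in>children a v. tail_weight T (gam T w a)) =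
      ?z * (\<Sum>w\<in>children a v. \<Prod>w'\<in>children a v - {w}. ?q w')"
    using tail_weight_child[OF assms(1-3)] by (simp add: sum_distrib_left)
  \<comment> \<open>The summand of \<open>w0\<close> omits its own decoration and is
    \<open>b\<close>; every other one keeps the factor \<open>?q w0\<close>.\<close>
  also have "(\<Sum>w\<in>children a v. \<Prod>w'\<in>children a v - {w}. ?q w') =
      b + (\<Sum>w\<in>K. \<Prod>w'\<in>children a v - {w}. ?q w')"
    unfolding ch(1) using ch(2,3) by (simp add: b_def)
  also have "(\<Sum>w\<in>K. \<Prod>w'\<in>children a v - {w}. ?q w') = ?q w0 * (\<Sum>w\<in>K. \<Prod>w'\<in>K - {w}. ?q w')"
    using rem by (simp add: sum_distrib_left)
  also have "(\<Sum>w\<in>K. \<Prod>w'\<in>K - {w}. ?q w') = (int (card K) - 1) * b + 1"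
    unfolding b_def using one ch(3) by (intro sum_prod_remove_almost_one) auto
  finally have sum: "(\<Sum>w\<in>children a v. tail_weight T (gam T w a)) =
      ?z * (b + ?q w0 * ((int (card K) - 1) * b + 1))" .
  have "path_weight T (gam T v a) = ?q w0 * b * ?z"
    using path_weight_eq_hd_tail[OF gam_neq_Nil[OF assms(1,2)], of T] gam_path(2)[OF assms(1,2)]
      Qpath_start[OF assms(1-3)] ch by (simp add: b_def)
  moreover have "int (valency T v) - 2 = int (card K)"
    using valency_eq[OF assms(1-3)] ch by simp
  moreover have "correction a v = ?z * (?q w0 - 1) * (b - 1)"
    using Qpath_interior[OF assms]
    by (simp add: correction_def b_def K_def w0_def towards_def)
  ultimately show ?thesis
    unfolding sum by (simp add: algebra_simps)
qed

text \<open>The local balances are added up and telescope. The value -1 comes from the unique child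
  \<open>c\<close> of the arrow \<open>a\<close>, for which the path \<open>[c, a]\<close> has tail
  weight 1.\<close>

lemma sum_path_weight:
  assumes "a \<in> darrs T"
  shows "(\<Sum>v\<in>cells T - {a}. path_weight T (gam T v a) * (int (valency T v) - 2)) =
    - 1 + (\<Sum>v\<in>set (gam T v0 a) - {v0, a}. correction a v)"
proof -
  note a = arrow_cell[OF assms]
  let ?z = "\<lambda>w. tail_weight T (gam T w a)"
  let ?P = "set (gam T v0 a) - {v0, a}"
  have "(\<Sum>v\<in>cells T - {a}. path_weight T (gam T v a) * (int (valency T v) - 2)) =
      (\<Sum>v\<in>cells T - {a}. ((\<Sum>w\<in>children a v. ?z w) - ?z v) + (if v \<in> ?P then correction a v else 0))"
    using balance_on_path balance_off_path a by (intro sum.cong) auto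
  also have "\<dots> = - (\<Sum>w\<in>children a a. ?z w) +
      (\<Sum>v\<in>cells T - {a}. if v \<in> ?P then correction a v else 0)"
    by (simp add: sum.distrib telescoping_children_sum[OF a])
  also have "(\<Sum>v\<in>cells T - {a}. if v \<in> ?P then correction a v else 0) = (\<Sum>v\<in>?P. correction a v)"
    using finite_cells gam_subset[OF root_cell a]
    by (intro sum.mono_neutral_cong_right) auto
  also have "(\<Sum>w\<in>children a a. ?z w) = 1"
  proof -
    have ne: "v0 \<noteq> a" using assms root_notin_arrows by blast
    have e: "{e \<in> dedges T. a \<in> e} = (\<lambda>w. {a, w}) ` children a a"
    proof (intro equalityI subsetI)
      fix e assume "e \<in> {e \<in> dedges T. a \<in> e}"
      then obtain w where w: "e = {a, w}" "{a, w} \<in> dedges T" "w \<in> cells T"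
        using edge_other[of e a] by blast
      then have "w \<in> children a a"
        using towards_step[OF w(2) a] by (auto simp: children_def)
      then show "e \<in> (\<lambda>w. {a, w}) ` children a a" using w by blast
    qed (use childrenD(3)[OF _ a] in auto)
    then have "card (children a a) = 1"
      using arrow_valency[OF assms] card_image[OF inj_child_edge, of a "children a a"]
      by (simp add: valency_def)
    then obtain c where c: "children a a = {c}" by (auto simp: card_1_singleton_iff)
    then have cc: "c \<in> children a a" by simp
    have g: "gam T c a = [c, a]"
      using childrenD(4)[OF cc a] gam_refl[OF a] by simp
    have "Qpath T (gam T a c) a = 1"
      using Qpath_arrow_end[OF assms] childrenD(1,2)[OF cc a] by simp
    then have "Qpath T (gam T c a) a = 1"
      using gam_rev[OF childrenD(1)[OF cc a] a] by (simp add: Qpath_def)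
    then show ?thesis
      using c g childrenD(2)[OF cc a] by (simp add: tail_weight_def)
  qed
  finally show ?thesis .
qed

text \<open>\<open>Qstar\<close> skips the two ends; these are arrows, whose only edge is in the
  path, so their factors are empty products.\<close>

lemma path_weight_eq_Qstar:
  assumes "a \<in> darrs T" "b \<in> darrs T" "a \<noteq> b"
  shows "Qstar T (gam T a b) = path_weight T (gam T a b)"
proof -
  note c = arrow_cell[OF assms(1)] arrow_cell[OF assms(2)]
  let ?g = "gam T a b"
  have ends: "Qpath T ?g a = 1" "Qpath T ?g b = 1"
    using Qpath_arrow_end[OF assms(1) c(2)] Qpath_arrow_end[OF assms(2) c(1)] assms(3)
      gam_rev[OF c] by (auto simp: Qpath_def)
  define n where "n = length ?g - 1"
  have len: "length ?g = Suc n" using gam_neq_Nil[OF c] by (simp add: n_def)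
  have 0: "?g ! 0 = a" "?g ! n = b"
    using gam_path(2,3)[OF c] gam_neq_Nil[OF c] by (simp_all add: hd_conv_nth last_conv_nth n_def)
  have "path_weight T ?g = (\<Prod>i\<in>{..n}. Qpath T ?g (?g ! i))"
  proof -
    have "set ?g = (!) ?g ` {..n}"
      using len by (auto simp: in_set_conv_nth less_Suc_eq_le image_iff)
    moreover have "inj_on ((!) ?g) {..n}"
      using distinct_gam[OF c] len by (intro inj_on_nth) auto
    ultimately show ?thesis
      by (simp add: path_weight_def prod.reindex)
  qed
  also have "\<dots> = (\<Prod>i\<in>{0<..<n}. Qpath T ?g (?g ! i))"
  proof (rule prod.mono_neutral_right)
    show "\<forall>i\<in>{..n} - {0<..<n}. Qpath T ?g (?g ! i) = 1"
    proof
      fix i assume "i \<in> {..n} - {0<..<n}"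
      then have "i = 0 \<or> i = n" by auto
      then show "Qpath T ?g (?g ! i) = 1" using 0 ends by auto
    qed
  qed auto
  finally show ?thesis
    by (simp add: Qstar_def n_def)
qed

end

section \<open>The number \<open>M\<close> as a sum over arrows\<close>

context pseudo_rooted_tree
begin

lemma edges_at_arrow:
  assumes "a \<in> darrs T"
  shows "{e \<in> dedges T. a \<in> e} = {{a, towards v0 a}}"
proof -
  have "v0 \<noteq> a" using assms root_notin_arrows by blast
  then show ?thesis
    using edges_at[OF arrow_cell[OF assms] root_cell] arrow_children_empty[OF assms root_cell] by auto
qed

text \<open>The value of the sum in \<open>sum_path_weight\<close>, named because it is the same for
  \<open>T\<close> and \<open>T_X\<close>.\<close>

definition path_sum :: "'c \<Rightarrow> int" where
  "path_sum a = - 1 + (\<Sum>v\<in>set (gam T v0 a) - {v0, a}. correction a v)"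

lemma finite_arrsN: "finite (arrsN T)"
  using graph by (simp add: arrsN_def is_graph_def)

text \<open>The sum defining \<open>M\<close> runs over vertices and arrows with
  \<open>f = 0\<close>. Compared with all cells other than \<open>a\<close> it lacks the arrows
  \<open>b\<close> with nonzero \<open>f\<close>, where the valency minus 2 is -1; this accounts for
  the inner sum on the right.\<close>

lemma neg_Mval_eq:
  "- Mval T = (\<Sum>a\<in>arrsN T. dfdec T a *
     (path_sum a + (\<Sum>b\<in>arrsN T - {a}. path_weight T (gam T b a))))"
proof -
  let ?W = "dverts T \<union> arrs0 T"
  have fin: "finite ?W" "?W \<subseteq> cells T"
    using graph by (auto simp: is_graph_def arrs0_def cells_def)
  have "- Mval T = (\<Sum>v\<in>?W. \<Sum>a\<in>arrsN T. xval T v a * (int (valency T v) - 2))"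
    by (simp add: Mval_def Nval_def sum_distrib_right)
  also have "\<dots> = (\<Sum>a\<in>arrsN T. \<Sum>v\<in>?W. xval T v a * (int (valency T v) - 2))"
    by (rule sum.swap)
  also have "\<dots> = (\<Sum>a\<in>arrsN T. dfdec T a *
     (path_sum a + (\<Sum>b\<in>arrsN T - {a}. path_weight T (gam T b a))))"
  proof (rule sum.cong[OF refl])
    fix a assume a: "a \<in> arrsN T"
    then have arr: "a \<in> darrs T" by (simp add: arrsN_def)
    let ?h = "\<lambda>v. path_weight T (gam T v a) * (int (valency T v) - 2)"
    have split: "cells T - {a} = ?W \<union> (arrsN T - {a})" "?W \<inter> (arrsN T - {a}) = {}"
      using a graph by (auto simp: cells_def arrsN_def arrs0_def is_graph_def)
    have "(\<Sum>v\<in>cells T - {a}. ?h v) = (\<Sum>v\<in>?W. ?h v) + (\<Sum>v\<in>arrsN T - {a}. ?h v)"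
      unfolding split(1) using split(2) fin finite_arrsN by (intro sum.union_disjoint) auto
    moreover have "(\<Sum>v\<in>arrsN T - {a}. ?h v) = - (\<Sum>v\<in>arrsN T - {a}. path_weight T (gam T v a))"
      unfolding sum_negf[symmetric]
      using arrow_valency by (intro sum.cong) (auto simp: arrsN_def)
    ultimately have "(\<Sum>v\<in>?W. ?h v) = path_sum a + (\<Sum>b\<in>arrsN T - {a}. path_weight T (gam T b a))"
      using sum_path_weight[OF arr] by (simp add: path_sum_def)
    moreover have "(\<Sum>v\<in>?W. xval T v a * (int (valency T v) - 2)) = dfdec T a * (\<Sum>v\<in>?W. ?h v)"
      unfolding sum_distrib_left
      using fin(2) xval_eq[OF _ arrow_cell[OF arr]] by (intro sum.cong) (auto simp: subset_iff)
    ultimately show "(\<Sum>v\<in>?W. xval T v a * (int (valency T v) - 2)) =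
        dfdec T a * (path_sum a + (\<Sum>b\<in>arrsN T - {a}. path_weight T (gam T b a)))"
      by simp
  qed
  finally show ?thesis .
qed

end

section \<open>The tree spanned by a set of arrows\<close>

locale rooted_graph =
  fixes G :: "('c, 'z) dtree_scheme" and r :: 'c and rk :: "'c \<Rightarrow> nat" and p :: "'c \<Rightarrow> 'c"
  assumes graph: "is_graph G"
    and root: "r \<in> cells G"
    and parent: "x \<in> cells G \<Longrightarrow> x \<noteq> r \<Longrightarrow> {x, p x} \<in> dedges G \<and> rk (p x) < rk x"
    and edge: "e \<in> dedges G \<Longrightarrow> \<exists>x\<in>cells G. x \<noteq> r \<and> e = {x, p x}"
begin

lemma edge_cases:
  assumes "{x, y} \<in> dedges G"
  shows "(y = p x \<and> rk y < rk x) \<or> (x = p y \<and> rk x < rk y)"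
  using edge[OF assms] parent by (auto simp: doubleton_eq_iff)

text \<open>After a step up in rank the only way down from \<open>y\<close> is the edge just used,
  so the path keeps rising.\<close>

lemma ascending:
  "is_path G (x # y # s) \<Longrightarrow> rk x < rk y \<Longrightarrow> rk y \<le> rk (last (y # s))"
proof (induction s arbitrary: x y)
  case (Cons z s)
  have "{x, y} \<in> dedges G" "{y, z} \<in> dedges G" "{x, y} \<noteq> {y, z}"
    using Cons.prems(1) by (auto simp: is_path_def)
  then have "rk y < rk z"
    using edge_cases[of x y] edge_cases[of y z] Cons.prems(2) by (auto simp: insert_commute)
  moreover have "is_path G (y # z # s)"
    using is_path_suffix[of G "[x]" y "z # s"] Cons.prems(1) by simp
  ultimately show ?case using Cons.IH[of y z] by simp
qed simp

text \<open>A first step upwards would force the path to end above its start.\<close>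

lemma descending:
  assumes "is_path G (x # y # s)" "rk (last (y # s)) \<le> rk x"
  shows "y = p x" "rk y < rk x"
proof -
  have "{x, y} \<in> dedges G" using assms(1) by (simp add: is_path_def)
  moreover have "\<not> rk x < rk y"
    using ascending[OF assms(1)] assms(2) by linarith
  ultimately show "y = p x" "rk y < rk x"
    using edge_cases by blast+
qed

lemma is_path_rev: "is_path G xs \<Longrightarrow> is_path G (rev xs)"
  by (simp add: is_path_def pedges_list_rev)

text \<open>A closed path of positive length leaves \<open>x\<close> through the edge to
  \<open>p x\<close>. The reverse of its remainder is a path from \<open>x\<close> to
  \<open>p x\<close> and starts with the same edge, which would thus be used twice.\<close>

lemma closed_path:
  assumes "is_path G (x # s)" "last (x # s) = x"
  shows "s = []"
proof (rule ccontr)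
  assume "s \<noteq> []"
  then obtain y t where s: "s = y # t" by (cases s) auto
  have y: "y = p x" and less: "rk y < rk x"
    using descending[of x y t] assms s by auto
  define R where "R = rev (y # t)"
  have R: "is_path G R"
    unfolding R_def using is_path_suffix[of G "[x]" y t] assms(1) s by (intro is_path_rev) simp
  have ends: "hd R = x" "last R = y" "R \<noteq> []"
    using assms(2) s by (simp_all add: R_def hd_rev last_rev del: rev.simps)
  then obtain z u where zu: "R = x # z # u"
    using less by (cases R; cases "tl R") auto
  then have "z = p x"
    using descending[of x z u] R ends less by simp
  then have "{x, y} \<in> pedges R"
    using zu y by simp
  then have "{x, y} \<in> pedges (y # t)"
    by (simp only: pedges_rev R_def)
  then show False
    using assms(1) s by (simp add: is_path_def pedges_def)
qed

text \<open>After a reversal if necessary, the first cell has rank at least that of the last, so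
  both paths start with the step to the same parent, which is stripped off. The claim
  \<open>step\<close> covers any pair whose first list is as long as \<open>xs\<close>, hence also
  the reversed pair.\<close>

lemma path_unique:
  "is_path G xs \<Longrightarrow> is_path G ys \<Longrightarrow> hd xs = hd ys \<Longrightarrow> last xs = last ys \<Longrightarrow> xs = ys"
proof (induction "length xs" arbitrary: xs ys rule: less_induct)
  case less
  have step: "xs' = ys'" if path: "is_path G xs'" "is_path G ys'" and hd_eq: "hd xs' = hd ys'"
      and last_eq: "last xs' = last ys'" and rk_le: "rk (last xs') \<le> rk (hd xs')"
      and len: "length xs' = length xs" for xs' ys'
  proof -
    have "xs' \<noteq> []" "ys' \<noteq> []"
      using path by (auto simp: is_path_def)
    then obtain x s t where st: "xs' = x # s" "ys' = x # t"
      using hd_eq by (cases xs'; cases ys') auto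
    show ?thesis
    proof (cases "s = [] \<or> t = []")
      case True
      then have "last xs' = x" "last ys' = x"
        using st last_eq by auto
      then have "s = []" "t = []"
        using closed_path[of x s] closed_path[of x t] path st by simp_all
      then show ?thesis using st by simp
    next
      case False
      then obtain y s' z t' where s': "s = y # s'" "t = z # t'"
        by (meson list.exhaust)
      have "y = p x"
        using descending(1)[of x y s'] path(1) rk_le unfolding st s' by simp
      moreover have "z = p x"
        using descending(1)[of x z t'] path(2) rk_le last_eq unfolding st s' by simp
      moreover have "is_path G s" "is_path G t"
        using is_path_suffix[of G "[x]"] path unfolding st s' by simp_all
      ultimately have "s = t"
        using less.hyps[of s t] len last_eq unfolding st s' by simp
      then show ?thesis using st by simp
    qed
  qed
  show ?case
  proof (cases "rk (last xs) \<le> rk (hd xs)")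
    case True
    then show ?thesis using step less.prems by blast
  next
    case False
    have "xs \<noteq> []" "ys \<noteq> []" using less.prems by (auto simp: is_path_def)
    then have "rev xs = rev ys"
      using False less.prems by (intro step is_path_rev) (auto simp: hd_rev last_rev)
    then show ?thesis by simp
  qed
qed

lemma walk_to_root:
  "x \<in> cells G \<Longrightarrow> \<exists>xs. xs \<noteq> [] \<and> hd xs = x \<and> last xs = r \<and> pedges xs \<subseteq> dedges G"
proof (induction "rk x" arbitrary: x rule: less_induct)
  case less
  show ?case
  proof (cases "x = r")
    case True
    then show ?thesis by (intro exI[of _ "[x]"]) auto
  next
    case False
    have px: "{x, p x} \<in> dedges G" "rk (p x) < rk x"
      using parent[OF less.prems False] by auto
    have "p x \<in> cells G"
      using graph px(1) by (auto elim!: graph_edgeE simp: doubleton_eq_iff)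
    then obtain xs where xs: "xs \<noteq> []" "hd xs = p x" "last xs = r" "pedges xs \<subseteq> dedges G"
      using less.hyps[OF px(2)] by blast
    then show ?thesis
      using px by (cases xs) (auto intro!: exI[of _ "x # xs"])
  qed
qed

text \<open>A path exists by joining two walks to the root and erasing loops.\<close>

lemma is_tree: "is_tree G"
  unfolding is_tree_def
proof (intro conjI ballI graph)
  fix x y assume xy: "x \<in> cells G" "y \<in> cells G"
  obtain xs ys where xs: "xs \<noteq> []" "hd xs = x" "last xs = r" "pedges xs \<subseteq> dedges G"
    and ys: "ys \<noteq> []" "hd ys = y" "last ys = r" "pedges ys \<subseteq> dedges G"
    using walk_to_root xy by meson
  obtain xs' where xs': "xs = xs' @ [r]"
    using xs by (metis append_butlast_last_id)
  obtain ys' where ys': "rev ys = r # ys'"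
    using ys by (metis hd_rev list.collapse rev_is_Nil_conv)
  let ?w = "xs' @ r # ys'"
  have "pedges ?w = pedges xs \<union> pedges (rev ys)"
    using pedges_append[of xs' r ys'] xs' ys' by simp
  then have "pedges ?w \<subseteq> dedges G"
    using xs ys by simp
  moreover have "hd ?w = x" using xs(2) xs' by (cases xs') auto
  moreover have "last ?w = y"
    using ys(1,2) ys' last_rev[of ys] by simp
  moreover obtain zs where "zs \<noteq> []" "distinct zs" "hd zs = hd ?w" "last zs = last ?w"
      "pedges zs \<subseteq> pedges ?w"
    using walk_contains_distinct_walk[of ?w] by blast
  ultimately have "is_path G zs \<and> hd zs = x \<and> last zs = y"
    using xy by (intro conjI is_pathI graph) auto
  then show "\<exists>!xs. is_path G xs \<and> hd xs = x \<and> last xs = y"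
    using path_unique by (intro ex1I[of _ zs]) auto
qed

end

section \<open>Comparison of \<open>T_X\<close> with \<open>T\<close>\<close>

locale arrow_subset = pseudo_rooted_tree T v0
  for T :: "('c, 'z) dtree_scheme" and v0 :: 'c +
  fixes X :: "'c set"
  assumes X_arrows: "X \<subseteq> arrsN T" and X_nonempty: "X \<noteq> {}"
begin

abbreviation "XV \<equiv> TXverts T v0 X"
abbreviation "XE \<equiv> TXedges T v0 X"
abbreviation "Xb \<equiv> bval T v0 X"
abbreviation "XB \<equiv> {v \<in> XV. Xb v \<noteq> 1}"
abbreviation "XC \<equiv> XV \<union> X"
abbreviation "G \<equiv> TX T v0 X"

lemma TX_sel:
  "dverts G = Inl ` XV"
  "darrs G = Inl ` X \<union> Inr ` XB"
  "dedges G = (`) Inl ` XE \<union> (\<lambda>v. {Inl v, Inr v}) ` XB"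
  "dfdec G (Inl c) = dfdec T c"
  "dfdec G (Inr c) = 0"
  "dqdec G (Inl ` e) (Inl c) = dqdec T e c"
  "dqdec G {Inl v, Inr v} (Inl v) = Xb v"
  by (simp_all add: TX_def Let_def image_iff inj_vimage_image_eq)

lemma cells_TX: "cells G = Inl ` XC \<union> Inr ` XB"
  by (auto simp: cells_def TX_sel)

lemma X_darrs: "a \<in> X \<Longrightarrow> a \<in> darrs T"
  using X_arrows by (auto simp: arrsN_def)

lemma finite_X: "finite X"
  using X_arrows finite_arrsN by (rule finite_subset)

lemma XC_cells: "x \<in> XC \<Longrightarrow> x \<in> cells T"
  using X_darrs by (auto simp: TXverts_def cells_def)

lemma XE_edges: "e \<in> XE \<Longrightarrow> e \<in> dedges T"
  by (simp add: TXedges_def)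

text \<open>An arrow on the path can only be its end \<open>a\<close>, by
  \<open>arrow_inner\<close>; all other cells are vertices.\<close>

lemma gam_in_XC: "a \<in> X \<Longrightarrow> set (gam T v0 a) \<subseteq> XC"
proof
  fix x assume a: "a \<in> X" and x: "x \<in> set (gam T v0 a)"
  have "x \<in> cells T"
    using x gam_subset[OF root_cell] XC_cells a by blast
  then consider "x \<in> dverts T" | "x \<in> darrs T" by (auto simp: cells_def)
  then show "x \<in> XC"
  proof cases
    case 1
    then show ?thesis using a x by (auto simp: TXverts_def)
  next
    case 2
    then have "x = a"
      using arrow_inner[of x v0 a] x a root_cell root_notin_arrows XC_cells by blast
    then show ?thesis using a by simp
  qed
qed

lemma XC_on_path: "x \<in> XC \<Longrightarrow> \<exists>a\<in>X. x \<in> set (gam T v0 a)"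
  using gam_ends[OF root_cell] XC_cells by (auto simp: TXverts_def)

lemma root_XV: "v0 \<in> XV"
  using X_nonempty gam_ends[OF root_cell] XC_cells root_vertex by (auto simp: TXverts_def)

lemma pedges_root_XE:
  assumes "x \<in> XC"
  shows "pedges (gam T v0 x) \<subseteq> XE"
proof -
  obtain a where a: "a \<in> X" "x \<in> set (gam T v0 a)"
    using XC_on_path assms by blast
  then have "pedges (gam T v0 x) \<subseteq> pedges (gam T v0 a)"
    using pedges_gam_split[OF root_cell] XC_cells by blast
  moreover have "pedges (gam T v0 a) \<subseteq> dedges T"
    using pedges_gam_subset[OF root_cell] XC_cells a by blast
  ultimately show ?thesis
    using a(1) by (auto simp: TXedges_def)
qed

text \<open>The set \<open>XE\<close> is defined by paths from \<open>v0\<close>; a detour through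
  \<open>v0\<close> extends this to paths between any two surviving cells.\<close>

lemma pedges_XE: "x \<in> XC \<Longrightarrow> y \<in> XC \<Longrightarrow> pedges (gam T x y) \<subseteq> XE"
  using pedges_gam_triangle[OF XC_cells XC_cells root_cell] pedges_root_XE by blast

lemma XE_XC: "e \<in> XE \<Longrightarrow> e \<subseteq> XC"
  using pedges_subset gam_in_XC unfolding TXedges_def by fast

lemma towards_root_XE:
  assumes "x \<in> XC" "x \<noteq> v0"
  shows "{x, towards v0 x} \<in> XE"
proof -
  have "{x, towards v0 x} \<in> pedges (gam T x v0)"
    using first_edge_gam[OF XC_cells root_cell] assms by auto
  then show ?thesis
    using pedges_XE[of x v0] assms root_XV by auto
qed

lemma XE_towards_root:
  assumes "e \<in> XE"
  shows "\<exists>x\<in>XC. x \<noteq> v0 \<and> e = {x, towards v0 x}"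
proof -
  obtain x y where xy: "e = {x, y}" "{x, y} \<in> dedges T"
    using graph_edgeE[OF graph XE_edges[OF assms]] XE_edges[OF assms] by metis
  have c: "x \<in> XC" "y \<in> XC" using XE_XC[OF assms] xy by auto
  show ?thesis
  proof (cases "y = towards v0 x \<and> x \<noteq> v0")
    case True
    then show ?thesis using xy c by blast
  next
    case False
    then have "towards v0 y = x" "y \<noteq> v0"
      using towards_step[OF xy(2) root_cell] by auto
    then show ?thesis using xy c by (intro bexI[of _ y]) auto
  qed
qed

lemma TX_is_graph: "is_graph G"
  unfolding is_graph_def
proof (intro conjI ballI)
  have "XV \<subseteq> dverts T" by (auto simp: TXverts_def)
  then show "finite (dverts G)" "finite (darrs G)" "dverts G \<inter> darrs G = {}"
    using graph finite_subset[of XV "dverts T"] finite_X X_darrs by (auto simp: is_graph_def TX_sel)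
next
  fix e assume "e \<in> dedges G"
  then consider e' where "e' \<in> XE" "e = Inl ` e'" | v where "v \<in> XB" "e = {Inl v, Inr v}"
    by (auto simp: TX_sel)
  then show "\<exists>x y. x \<noteq> y \<and> e = {x, y} \<and> x \<in> cells G \<and> y \<in> cells G"
  proof cases
    case 1
    obtain x y where "e' = {x, y}" "x \<noteq> y"
      using graph_edgeE[OF graph XE_edges[OF 1(1)]] by metis
    then show ?thesis
      using 1 XE_XC[OF 1(1)] by (intro exI[of _ "Inl x"] exI[of _ "Inl y"]) (auto simp: cells_TX)
  next
    case 2
    then show ?thesis
      by (intro exI[of _ "Inl v"] exI[of _ "Inr v"]) (auto simp: cells_TX)
  qed
qed

text \<open>The parent of an old cell is the next cell towards \<open>v0\<close>, that of a new
  arrow \<open>Inr v\<close> is \<open>Inl v\<close>; the rank is the number of cells on the path to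
  the root.\<close>

sublocale TX_graph: rooted_graph G "Inl v0"
  "case_sum (\<lambda>x. length (gam T x v0)) (\<lambda>v. Suc (length (gam T v v0)))"
  "case_sum (\<lambda>x. Inl (towards v0 x)) Inl"
proof (unfold_locales, goal_cases)
  case 1
  show ?case by (rule TX_is_graph)
next
  case 2
  show ?case using root_XV by (auto simp: cells_TX)
next
  case (3 x)
  then consider c where "x = Inl c" "c \<in> XC" "c \<noteq> v0" | v where "x = Inr v" "v \<in> XB"
    by (auto simp: cells_TX)
  then show ?case
  proof cases
    case 1
    have "Inl ` {c, towards v0 c} \<in> dedges G"
      using towards_root_XE 1 unfolding TX_sel by blast
    moreover have "gam T c v0 = c # gam T (towards v0 c) v0"
      using gam_Cons(1)[OF XC_cells root_cell] 1 by blast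
    ultimately show ?thesis using 1 by simp
  next
    case 2
    then show ?thesis by (auto simp: TX_sel insert_commute)
  qed
next
  case (4 e)
  then consider e' where "e' \<in> XE" "e = Inl ` e'" | v where "v \<in> XB" "e = {Inl v, Inr v}"
    by (auto simp: TX_sel)
  then show ?case
  proof cases
    case 1
    then obtain x where "x \<in> XC" "x \<noteq> v0" "e' = {x, towards v0 x}"
      using XE_towards_root by blast
    then show ?thesis
      using 1 by (intro bexI[of _ "Inl x"]) (auto simp: cells_TX)
  next
    case 2
    then show ?thesis
      by (intro bexI[of _ "Inr v"]) (auto simp: cells_TX)
  qed
qed

sublocale TX_tree: path_tree G
  by unfold_locales (rule TX_graph.is_tree)

text \<open>The tagged path lies in \<open>T_X\<close>, and by uniqueness it is the path
  there.\<close>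

lemma gam_TX:
  assumes "x \<in> XC" "y \<in> XC"
  shows "gam G (Inl x) (Inl y) = map Inl (gam T x y)"
proof (rule TX_tree.gam_eqI)
  note c = XC_cells[OF assms(1)] XC_cells[OF assms(2)]
  show hd: "hd (map Inl (gam T x y)) = Inl x"
    using gam_path(2)[OF c] gam_neq_Nil[OF c] by (simp add: hd_map)
  show "last (map Inl (gam T x y)) = Inl y"
    using gam_path(3)[OF c] gam_neq_Nil[OF c] by (simp add: last_map)
  have "pedges (map Inl (gam T x y)) \<subseteq> dedges G"
    using pedges_XE[OF assms] by (auto simp: pedges_map TX_sel)
  then show "is_path G (map Inl (gam T x y))"
    using hd assms(1) gam_neq_Nil[OF c] distinct_gam[OF c]
    by (intro is_pathI TX_is_graph) (auto simp: cells_TX distinct_map)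
qed

lemma gam_subset_XC:
  assumes "x \<in> XC" "y \<in> XC"
  shows "set (gam T x y) \<subseteq> XC"
proof -
  have "set (map Inl (gam T x y)) \<subseteq> cells G"
    using TX_tree.gam_subset[of "Inl x" "Inl y"] assms gam_TX[OF assms] by (auto simp: cells_TX)
  then show ?thesis by (auto simp: cells_TX)
qed

lemma edges_at_TX:
  "{e \<in> dedges G. Inl u \<in> e} =
    (`) Inl ` {e \<in> XE. u \<in> e} \<union> (if u \<in> XB then {{Inl u, Inr u}} else {})"
  by (auto simp: TX_sel)

text \<open>The only edge at an arrow of \<open>X\<close> leads towards \<open>v0\<close> and is
  kept, so \<open>Xb a\<close> is an empty product.\<close>

lemma edges_at_X:
  assumes "a \<in> X"
  shows "{e \<in> XE. a \<in> e} = {{a, towards v0 a}}" "Xb a = 1"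
proof -
  have "a \<noteq> v0" using root_notin_arrows X_darrs assms by blast
  then have *: "{a, towards v0 a} \<in> XE"
    using towards_root_XE assms by simp
  have only: "e = {a, towards v0 a}" if "e \<in> dedges T" "a \<in> e" for e
    using edges_at_arrow[OF X_darrs[OF assms]] that by auto
  show "{e \<in> XE. a \<in> e} = {{a, towards v0 a}}"
    using only * XE_edges by auto
  have "{e \<in> dedges T. a \<in> e \<and> e \<notin> XE} = {}"
    using only * by auto
  then show "Xb a = 1" unfolding bval_def by (simp only: prod.empty)
qed

text \<open>\<open>Xb u\<close> is the product of the decorations at \<open>u\<close> on discarded
  edges, and it re-enters through the new edge; where no new arrow is attached it equals 1.\<close>

lemma Qpath_TX:
  assumes "u \<in> XC" "pedges g \<subseteq> XE"
  shows "Qpath G (map Inl g) (Inl u) = Qpath T g u"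
proof -
  let ?A = "{e \<in> XE. u \<in> e \<and> e \<notin> pedges g}"
  let ?N = "if u \<in> XB then {{Inl u, Inr u}} else {}"
  have inj: "inj_on ((`) Inl) ?A"
    by (auto simp: inj_on_def inj_image_eq_iff)
  have fin: "finite ?A"
    by (rule finite_subset[OF _ finite_edges]) (auto simp: TXedges_def)
  have new: "{Inl u, Inr u} \<notin> (`) Inl ` S" for S :: "'c set set"
    by auto
  have "{\<epsilon> \<in> dedges G. Inl u \<in> \<epsilon> \<and> \<epsilon> \<notin> pedges (map Inl g)} =
      {\<epsilon> \<in> dedges G. Inl u \<in> \<epsilon>} - (`) Inl ` pedges g"
    by (auto simp: pedges_map)
  also have "\<dots> = (`) Inl ` ?A \<union> ?N"
    unfolding edges_at_TX using new by (auto simp: inj_image_eq_iff)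
  finally have "Qpath G (map Inl g) (Inl u) = (\<Prod>\<epsilon>\<in>(`) Inl ` ?A \<union> ?N. dqdec G \<epsilon> (Inl u))"
    by (simp add: Qpath_def)
  also have "\<dots> = (\<Prod>\<epsilon>\<in>(`) Inl ` ?A. dqdec G \<epsilon> (Inl u)) * (\<Prod>\<epsilon>\<in>?N. dqdec G \<epsilon> (Inl u))"
    using fin new by (intro prod.union_disjoint) auto
  also have "(\<Prod>\<epsilon>\<in>(`) Inl ` ?A. dqdec G \<epsilon> (Inl u)) = (\<Prod>\<epsilon>\<in>?A. dqdec T \<epsilon> u)"
    by (simp add: prod.reindex[OF inj] TX_sel)
  also have "(\<Prod>\<epsilon>\<in>?N. dqdec G \<epsilon> (Inl u)) = Xb u"
    using assms(1) edges_at_X(2) by (auto simp: TX_sel)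
  also have "(\<Prod>\<epsilon>\<in>?A. dqdec T \<epsilon> u) * Xb u = Qpath T g u"
  proof -
    have "{\<epsilon> \<in> dedges T. u \<in> \<epsilon> \<and> \<epsilon> \<notin> pedges g} = ?A \<union> {e \<in> dedges T. u \<in> e \<and> e \<notin> XE}"
      using assms(2) XE_edges by blast
    then show ?thesis
      unfolding Qpath_def bval_def using finite_edges fin
      by (simp add: prod.union_disjoint[symmetric] disjoint_iff)
  qed
  finally show ?thesis .
qed

lemma weights_TX:
  assumes "x \<in> XC" "y \<in> XC"
  shows "path_weight G (map Inl (gam T x y)) = path_weight T (gam T x y)"
    "tail_weight G (map Inl (gam T x y)) = tail_weight T (gam T x y)"
proof -
  let ?g = "gam T x y"
  have q: "Qpath G (map Inl ?g) (Inl u) = Qpath T ?g u" if "u \<in> set ?g" for u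
    using Qpath_TX pedges_XE[OF assms] gam_subset_XC[OF assms] that by blast
  then show "path_weight G (map Inl ?g) = path_weight T ?g"
    by (simp add: path_weight_def prod.reindex)
  have *: "set (map Inl ?g) - {hd (map Inl ?g)} = Inl ` (set ?g - {hd ?g})"
    using gam_neq_Nil[OF XC_cells XC_cells] assms by (auto simp: hd_map)
  show "tail_weight G (map Inl ?g) = tail_weight T ?g"
    unfolding tail_weight_def * using q by (subst prod.reindex) auto
qed

lemma root_Xb: "Xb v0 = 1"
  unfolding bval_def using root by (auto simp: pseudo_root_def intro!: prod.neutral)

lemma TX_pseudo_root: "pseudo_root G (Inl v0)"
  unfolding pseudo_root_def
proof (intro conjI ballI impI)
  show "Inl v0 \<in> dverts G" using root_XV by (simp add: TX_sel)
next
  fix e assume "e \<in> dedges G" "Inl v0 \<in> e"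
  then have "e \<in> (`) Inl ` {e \<in> XE. v0 \<in> e}"
    using edges_at_TX[of v0] root_Xb by auto
  then show "dqdec G e (Inl v0) = 1"
    using root XE_edges by (auto simp: TX_sel pseudo_root_def)
next
  fix v' assume "v' \<in> dverts G - {Inl v0}"
  then obtain v where v: "v' = Inl v" "v \<in> XV" "v \<noteq> v0"
    by (auto simp: TX_sel)
  have vert: "v \<in> dverts T" using v(2) by (simp add: TXverts_def)
  let ?S = "{e \<in> dedges T. v \<in> e \<and> e \<notin> pedges (gam T v0 v) \<and> dqdec T e v \<noteq> 1}"
  let ?S' = "{e \<in> dedges G. v' \<in> e \<and> e \<notin> pedges (gam G (Inl v0) v') \<and> dqdec G e v' \<noteq> 1}"
  have "card ?S \<le> 1" using root vert v(3) by (auto simp: pseudo_root_def)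
  then have S: "e = e'" if "e \<in> ?S" "e' \<in> ?S" for e e'
    using card_le_Suc0_iff_eq[of ?S] finite_edges that by simp
  have pe: "pedges (gam G (Inl v0) v') = (`) Inl ` pedges (gam T v0 v)"
    using gam_TX[of v0 v] root_XV v by (simp add: pedges_map)
  have old: "e \<in> (`) Inl ` (?S \<inter> XE) \<or> v \<in> XB \<and> e = {Inl v, Inr v}" if "e \<in> ?S'" for e
  proof -
    have "e \<in> (`) Inl ` {e \<in> XE. v \<in> e} \<union> (if v \<in> XB then {{Inl v, Inr v}} else {})"
      using that v edges_at_TX[of v] by blast
    then consider e' where "e = Inl ` e'" "e' \<in> XE" "v \<in> e'" | "v \<in> XB" "e = {Inl v, Inr v}"
      by (auto split: if_splits)
    then show ?thesis
    proof cases
      case 1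
      then have "e' \<in> ?S"
        using that XE_edges v unfolding pe by (auto simp: TX_sel)
      then show ?thesis using 1 by blast
    qed simp
  qed
  \<comment> \<open>A new arrow at \<open>v\<close> means that some discarded edge there has a
    decoration other than 1. This edge uses up the one exception allowed at \<open>v\<close> in
    \<open>T\<close>, so no kept edge off the path to \<open>v0\<close> is exceptional.\<close>
  have new: "?S \<inter> XE = {}" if v_XB: "v \<in> XB"
  proof -
    obtain e where e: "e \<in> dedges T" "v \<in> e" "e \<notin> XE" "dqdec T e v \<noteq> 1"
      using v_XB unfolding bval_def by (auto elim!: prod.not_neutral_contains_not_neutral)
    then have "e \<in> ?S" using pedges_root_XE[of v] v(2) by auto
    then show ?thesis using S[of e] e(3) by blast
  qed
  have "e = e'" if "e \<in> ?S'" "e' \<in> ?S'" for e e'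
    using old[OF that(1)] old[OF that(2)] new S by blast
  moreover have "finite ?S'" using TX_tree.finite_edges by simp
  ultimately show "card ?S' \<le> 1"
    using card_le_Suc0_iff_eq[of ?S'] by simp
qed

text \<open>This makes the formula for \<open>M\<close> available for \<open>T_X\<close>, under the
  prefix \<open>TX\<close>.\<close>

sublocale TX: pseudo_rooted_tree G "Inl v0"
proof
  fix a assume "a \<in> darrs G"
  then consider c where "a = Inl c" "c \<in> X" | v where "a = Inr v" "v \<in> XB"
    by (auto simp: TX_sel)
  then show "valency G a = 1"
  proof cases
    case 1
    then show ?thesis
      using edges_at_TX[of c] edges_at_X[OF 1(2)] by (simp add: valency_def)
  next
    case 2
    then have "{e \<in> dedges G. a \<in> e} = {{Inl v, Inr v}}"
      by (auto simp: TX_sel)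
    then show ?thesis by (simp add: valency_def)
  qed
qed (rule TX_pseudo_root)

lemma correction_TX:
  assumes "a \<in> X" "v \<in> XC" "v \<noteq> v0"
  shows "TX.correction (Inl a) (Inl v) = correction a v"
proof -
  have c: "a \<in> XC" "v0 \<in> XC" using assms root_XV by auto
  \<comment> \<open>The index 1 must be in range for \<open>! 1\<close> to commute with
    \<open>map Inl\<close>.\<close>
  have "1 < length (gam T v v0)"
    using gam_Cons(1,3)[OF XC_cells[OF assms(2)] root_cell assms(3)]
      gam_neq_Nil[of "towards v0 v", OF _ root_cell] by simp
  then have nth: "gam G (Inl v) (Inl v0) ! 1 = Inl (gam T v v0 ! 1)"
    using gam_TX[OF assms(2) c(2)] by simp
  have "dqdec G {Inl v, Inl w} (Inl v) = dqdec T {v, w} v" for w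
    using TX_sel(6)[of "{v, w}" v] by simp
  then show ?thesis
    unfolding TX.correction_def correction_def nth
    using gam_TX[OF assms(2) c(1)] gam_TX[OF c(2,1)] weights_TX[OF assms(2) c(1)]
      Qpath_TX[OF assms(2) pedges_XE[OF c(2,1)]] by simp
qed

lemma path_sum_TX:
  assumes "a \<in> X"
  shows "TX.path_sum (Inl a) = path_sum a"
proof -
  have c: "a \<in> XC" "v0 \<in> XC" using assms root_XV by auto
  have *: "set (gam G (Inl v0) (Inl a)) - {Inl v0, Inl a} = Inl ` (set (gam T v0 a) - {v0, a})"
    using gam_TX[OF c(2,1)] by auto
  have "TX.correction (Inl a) (Inl v) = correction a v"
    if "v \<in> set (gam T v0 a) - {v0, a}" for v
    using correction_TX assms that gam_in_XC by blast
  then show ?thesis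
    unfolding TX.path_sum_def path_sum_def * by (subst sum.reindex) auto
qed

lemma arrsN_TX: "arrsN G = Inl ` X"
  using X_arrows by (auto simp: arrsN_def arrs0_def TX_sel)

text \<open>The new arrows have \<open>f = 0\<close> and do not occur among the arrows summed over;
  path sums and weights agree with those of \<open>T\<close>.\<close>

lemma neg_Mval_TX:
  "- Mval G = (\<Sum>a\<in>X. dfdec T a * (path_sum a + (\<Sum>b\<in>X - {a}. path_weight T (gam T b a))))"
proof -
  have "(\<Sum>b\<in>Inl ` X - {Inl a}. path_weight G (gam G b (Inl a))) =
      (\<Sum>b\<in>X - {a}. path_weight T (gam T b a))" if "a \<in> X" for a
  proof -
    have *: "Inl ` X - {Inl a} = Inl ` (X - {a})" by auto
    show ?thesis
      unfolding * using that gam_TX weights_TX by (subst sum.reindex) auto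
  qed
  then show ?thesis
    unfolding TX.neg_Mval_eq arrsN_TX
    using path_sum_TX by (simp add: sum.reindex TX_sel)
qed

lemma Ftot_TX: "Ftot G = (\<Sum>a\<in>X. FX T v0 X a)"
  by (simp add: Ftot_def arrsN_TX sum.reindex FX_def)

end

section \<open>Partitions of the arrows\<close>

lemma sum_off_diagonal_swap:
  fixes g :: "'a \<Rightarrow> 'a \<Rightarrow> 'b::comm_monoid_add"
  assumes "finite I"
  shows "(\<Sum>i\<in>I. \<Sum>j\<in>I - {i}. g i j) = (\<Sum>i\<in>I. \<Sum>j\<in>I - {i}. g j i)"
proof -
  \<comment> \<open>An indicator makes the inner range independent of \<open>i\<close>, so that
    \<open>sum.swap\<close> applies.\<close>
  have off: "(\<Sum>j\<in>I - {i}. h j) = (\<Sum>j\<in>I. if j \<noteq> i then h j else 0)" for i and h :: "'a \<Rightarrow> 'b"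
    using assms by (intro sum.mono_neutral_cong_left) auto
  show ?thesis
    unfolding off by (subst sum.swap) (auto intro!: sum.cong)
qed

text \<open>By symmetry the parts above and below the diagonal have equal sums.\<close>

lemma sum_off_diagonal_symmetric:
  fixes g :: "nat \<Rightarrow> nat \<Rightarrow> real"
  assumes sym: "\<And>i j. i \<in> {1..n} \<Longrightarrow> j \<in> {1..n} \<Longrightarrow> g i j = g j i"
  shows "(\<Sum>i\<in>{1..n}. \<Sum>j\<in>{1..n} - {i}. g i j) =
    2 * (\<Sum>(i, j)\<in>{(i, j). 1 \<le> i \<and> i < j \<and> j \<le> n}. g i j)"
proof -
  let ?u = "\<lambda>i j. if i < j then g i j else 0"
  have *: "{(i, j). 1 \<le> i \<and> i < j \<and> j \<le> n} = Sigma {1..n} (\<lambda>i. {j \<in> {1..n}. i < j})"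
    by auto
  have upper: "(\<Sum>(i, j)\<in>{(i, j). 1 \<le> i \<and> i < j \<and> j \<le> n}. g i j) = (\<Sum>i\<in>{1..n}. \<Sum>j\<in>{1..n}. ?u i j)"
  proof -
    have "(\<Sum>(i, j)\<in>Sigma {1..n} (\<lambda>i. {j \<in> {1..n}. i < j}). g i j) =
        (\<Sum>i\<in>{1..n}. \<Sum>j\<in>{j \<in> {1..n}. i < j}. g i j)"
      by (rule sum.Sigma[symmetric]) auto
    also have "\<dots> = (\<Sum>i\<in>{1..n}. \<Sum>j\<in>{1..n}. ?u i j)"
      by (intro sum.cong refl sum.inter_filter) simp
    finally show ?thesis unfolding * .
  qed
  have "(\<Sum>j\<in>{1..n} - {i}. g i j) = (\<Sum>j\<in>{1..n}. ?u i j + ?u j i)" if "i \<in> {1..n}" for i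
    using sym that by (intro sum.mono_neutral_cong_left) auto
  then have "(\<Sum>i\<in>{1..n}. \<Sum>j\<in>{1..n} - {i}. g i j) = (\<Sum>i\<in>{1..n}. \<Sum>j\<in>{1..n}. ?u i j + ?u j i)"
    by (rule sum.cong[OF refl])
  also have "\<dots> = (\<Sum>i\<in>{1..n}. \<Sum>j\<in>{1..n}. ?u i j) + (\<Sum>i\<in>{1..n}. \<Sum>j\<in>{1..n}. ?u j i)"
    by (simp only: sum.distrib)
  also have "(\<Sum>i\<in>{1..n}. \<Sum>j\<in>{1..n}. ?u j i) = (\<Sum>i\<in>{1..n}. \<Sum>j\<in>{1..n}. ?u i j)"
    by (rule sum.swap)
  finally show ?thesis
    unfolding upper by simp
qed

context pseudo_rooted_tree
begin

lemma arrsN_darrs: "a \<in> arrsN T \<Longrightarrow> a \<in> darrs T"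
  by (simp add: arrsN_def)

lemma dfdec_nonzero: "a \<in> arrsN T \<Longrightarrow> dfdec T a \<noteq> 0"
  by (auto simp: arrsN_def arrs0_def)

lemma Ival_eq:
  assumes "X \<subseteq> arrsN T" "Y \<subseteq> arrsN T"
  shows "Ival T X Y = (\<Sum>a\<in>X. \<Sum>b\<in>Y - {a}. path_weight T (gam T a b) * dfdec T a * dfdec T b)"
proof -
  have fin: "finite X" "finite Y" using assms finite_arrsN finite_subset by auto
  have "{(a, b). a \<in> X \<and> b \<in> Y \<and> a \<noteq> b} = Sigma X (\<lambda>a. Y - {a})" by auto
  then have "Ival T X Y = (\<Sum>a\<in>X. \<Sum>b\<in>Y - {a}. Qstar T (gam T a b) * dfdec T a * dfdec T b)"
    using fin by (simp add: Ival_def sum.Sigma[symmetric])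
  also have "\<dots> = (\<Sum>a\<in>X. \<Sum>b\<in>Y - {a}. path_weight T (gam T a b) * dfdec T a * dfdec T b)"
    using assms path_weight_eq_Qstar[OF arrsN_darrs arrsN_darrs] by (intro sum.cong refl) auto
  finally show ?thesis .
qed

lemma Ival_disjoint:
  assumes "X \<subseteq> arrsN T" "Y \<subseteq> arrsN T" "X \<inter> Y = {}"
  shows "Ival T X Y = (\<Sum>a\<in>X. \<Sum>b\<in>Y. path_weight T (gam T a b) * dfdec T a * dfdec T b)"
  unfolding Ival_eq[OF assms(1,2)] using assms(3) by (intro sum.cong) auto

lemma Ival_commute:
  assumes "X \<subseteq> arrsN T" "Y \<subseteq> arrsN T" "X \<inter> Y = {}"
  shows "Ival T X Y = Ival T Y X"
proof -
  have w: "path_weight T (gam T b a) = path_weight T (gam T a b)" if "a \<in> X" "b \<in> Y" for a b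
  proof -
    have "a \<in> cells T" "b \<in> cells T"
      using that assms(1,2) arrow_cell[OF arrsN_darrs] by auto
    then show ?thesis using gam_rev[of a b] by simp
  qed
  have "Y \<inter> X = {}" using assms(3) by blast
  note Ival_YX = Ival_disjoint[OF assms(2,1) this]
  show ?thesis
    unfolding Ival_disjoint[OF assms] Ival_YX
    by (subst sum.swap) (intro sum.cong refl, simp add: w)
qed

text \<open>\<open>Ival T {a} (arrsN T - X)\<close> contains the nonzero factor
  \<open>dfdec T a\<close>, so the quotient merely removes this factor and both terms are
  integers.\<close>

lemma frakM_eq:
  assumes "X \<subseteq> arrsN T"
  shows "frakM T X = of_int (\<Sum>a\<in>X. \<Sum>b\<in>arrsN T - X. path_weight T (gam T a b) * dfdec T a * dfdec T b)
    - of_int (\<Sum>a\<in>X. \<Sum>b\<in>arrsN T - X. path_weight T (gam T a b) * dfdec T b)"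
proof -
  have "(1 - 1 / of_int (dfdec T a)) * of_int (Ival T {a} (arrsN T - X)) =
      of_int (\<Sum>b\<in>arrsN T - X. path_weight T (gam T a b) * dfdec T a * dfdec T b) -
      (of_int (\<Sum>b\<in>arrsN T - X. path_weight T (gam T a b) * dfdec T b) :: real)" if a: "a \<in> X" for a
  proof -
    let ?s = "\<Sum>b\<in>arrsN T - X. path_weight T (gam T a b) * dfdec T b"
    have I: "(\<Sum>b\<in>arrsN T - X. path_weight T (gam T a b) * dfdec T a * dfdec T b) = dfdec T a * ?s"
      by (simp add: sum_distrib_left mult.commute mult.left_commute)
    have "Ival T {a} (arrsN T - X) = dfdec T a * ?s"
      using Ival_disjoint[of "{a}" "arrsN T - X"] assms a I by auto
    moreover have "dfdec T a \<noteq> 0" using dfdec_nonzero assms a by blast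
    ultimately show ?thesis
      unfolding I by (simp add: field_simps del: of_int_sum)
  qed
  then show ?thesis
    unfolding frakM_def by (simp add: sum_subtractf)
qed

text \<open>The index type is arbitrary: the arrows themselves index the partition into singletons
  for (a) and (c), and \<open>{1..n}\<close> serves for (b) and (d).\<close>

context
  fixes I :: "'i set" and Xs :: "'i \<Rightarrow> 'c set"
  assumes finite_I: "finite I"
    and parts_nonempty: "\<And>i. i \<in> I \<Longrightarrow> Xs i \<noteq> {}"
    and parts_disjoint: "\<And>i j. i \<in> I \<Longrightarrow> j \<in> I \<Longrightarrow> i \<noteq> j \<Longrightarrow> Xs i \<inter> Xs j = {}"
    and parts_union: "(\<Union>i\<in>I. Xs i) = arrsN T"
begin

lemma part_subset: "i \<in> I \<Longrightarrow> Xs i \<subseteq> arrsN T"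
  using parts_union by blast

lemma part_arrow_subset: "i \<in> I \<Longrightarrow> arrow_subset T v0 (Xs i)"
  using part_subset parts_nonempty by unfold_locales auto

lemma finite_part: "i \<in> I \<Longrightarrow> finite (Xs i)"
  using part_subset finite_arrsN finite_subset by blast

lemma sum_parts:
  fixes h :: "'c \<Rightarrow> 'b::comm_monoid_add"
  shows "(\<Sum>a\<in>arrsN T. h a) = (\<Sum>i\<in>I. \<Sum>a\<in>Xs i. h a)"
  unfolding parts_union[symmetric]
  using finite_I finite_part parts_disjoint by (intro sum.UNION_disjoint) auto

lemma sum_other_parts:
  fixes h :: "'c \<Rightarrow> 'b::comm_monoid_add"
  assumes "i \<in> I"
  shows "(\<Sum>a\<in>arrsN T - Xs i. h a) = (\<Sum>j\<in>I - {i}. \<Sum>a\<in>Xs j. h a)"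
proof -
  have "arrsN T - Xs i = (\<Union>j\<in>I - {i}. Xs j)"
    unfolding parts_union[symmetric] using assms parts_disjoint by blast
  then show ?thesis
    using finite_I finite_part parts_disjoint by (simp add: sum.UNION_disjoint)
qed

text \<open>For \<open>a\<close> in \<open>Xs i\<close> the path sum and the weights from the same
  part are those of \<open>TX T v0 (Xs i)\<close>; only the weights from arrows in other parts are
  left over.\<close>

lemma neg_Mval_partition:
  "- Mval T = (\<Sum>i\<in>I. - Mval (TX T v0 (Xs i))) +
     (\<Sum>i\<in>I. \<Sum>j\<in>I - {i}. \<Sum>a\<in>Xs i. \<Sum>b\<in>Xs j. path_weight T (gam T b a) * dfdec T a)"
proof -
  have part: "(\<Sum>a\<in>Xs i. dfdec T a * (path_sum a + (\<Sum>b\<in>arrsN T - {a}. path_weight T (gam T b a)))) =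
      - Mval (TX T v0 (Xs i)) +
      (\<Sum>j\<in>I - {i}. \<Sum>a\<in>Xs i. \<Sum>b\<in>Xs j. path_weight T (gam T b a) * dfdec T a)"
    if i: "i \<in> I" for i
  proof -
    have "(\<Sum>b\<in>arrsN T - {a}. path_weight T (gam T b a)) =
        (\<Sum>b\<in>Xs i - {a}. path_weight T (gam T b a)) +
        (\<Sum>j\<in>I - {i}. \<Sum>b\<in>Xs j. path_weight T (gam T b a))" if a: "a \<in> Xs i" for a
    proof -
      have "arrsN T - {a} = (Xs i - {a}) \<union> (arrsN T - Xs i)"
        using a part_subset[OF i] by auto
      then have "(\<Sum>b\<in>arrsN T - {a}. path_weight T (gam T b a)) =
        (\<Sum>b\<in>Xs i - {a}. path_weight T (gam T b a)) + (\<Sum>b\<in>arrsN T - Xs i. path_weight T (gam T b a))"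
        using finite_part[OF i] finite_arrsN by (simp add: sum.union_disjoint disjoint_iff)
      then show ?thesis by (simp only: sum_other_parts[OF i])
    qed
    then have "(\<Sum>a\<in>Xs i. dfdec T a * (path_sum a + (\<Sum>b\<in>arrsN T - {a}. path_weight T (gam T b a)))) =
        (\<Sum>a\<in>Xs i. dfdec T a * (path_sum a + (\<Sum>b\<in>Xs i - {a}. path_weight T (gam T b a))) +
           (\<Sum>j\<in>I - {i}. \<Sum>b\<in>Xs j. path_weight T (gam T b a) * dfdec T a))"
      by (intro sum.cong) (auto simp: distrib_left sum_distrib_left mult.commute)
    also have "\<dots> = - Mval (TX T v0 (Xs i)) +
        (\<Sum>a\<in>Xs i. \<Sum>j\<in>I - {i}. \<Sum>b\<in>Xs j. path_weight T (gam T b a) * dfdec T a)"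
      using arrow_subset.neg_Mval_TX[OF part_arrow_subset[OF i]] by (simp add: sum.distrib)
    also have "(\<Sum>a\<in>Xs i. \<Sum>j\<in>I - {i}. \<Sum>b\<in>Xs j. path_weight T (gam T b a) * dfdec T a) =
        (\<Sum>j\<in>I - {i}. \<Sum>a\<in>Xs i. \<Sum>b\<in>Xs j. path_weight T (gam T b a) * dfdec T a)"
      by (rule sum.swap)
    finally show ?thesis .
  qed
  then show ?thesis
    unfolding neg_Mval_eq sum_parts by (simp add: sum.distrib sum_subtractf sum_negf)
qed

lemma sum_frakM:
  "(\<Sum>i\<in>I. frakM T (Xs i)) =
    of_int ((\<Sum>i\<in>I. \<Sum>j\<in>I - {i}. Ival T (Xs i) (Xs j)) -
      (\<Sum>i\<in>I. \<Sum>j\<in>I - {i}. \<Sum>a\<in>Xs i. \<Sum>b\<in>Xs j. path_weight T (gam T b a) * dfdec T a))"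
proof -
  let ?f = "dfdec T" and ?w = "\<lambda>a b. path_weight T (gam T a b)"
  have "frakM T (Xs i) = of_int (\<Sum>j\<in>I - {i}. Ival T (Xs i) (Xs j)) -
      of_int (\<Sum>j\<in>I - {i}. \<Sum>a\<in>Xs i. \<Sum>b\<in>Xs j. ?w a b * ?f b)" if i: "i \<in> I" for i
  proof -
    have "Ival T (Xs i) (Xs j) = (\<Sum>a\<in>Xs i. \<Sum>b\<in>Xs j. ?w a b * ?f a * ?f b)" if "j \<in> I - {i}" for j
      using Ival_disjoint part_subset parts_disjoint i that by auto
    then have "(\<Sum>j\<in>I - {i}. Ival T (Xs i) (Xs j)) =
        (\<Sum>a\<in>Xs i. \<Sum>j\<in>I - {i}. \<Sum>b\<in>Xs j. ?w a b * ?f a * ?f b)"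
      by (subst sum.swap) simp
    moreover have "(\<Sum>j\<in>I - {i}. \<Sum>a\<in>Xs i. \<Sum>b\<in>Xs j. ?w a b * ?f b) =
        (\<Sum>a\<in>Xs i. \<Sum>j\<in>I - {i}. \<Sum>b\<in>Xs j. ?w a b * ?f b)"
      by (rule sum.swap)
    ultimately show ?thesis
      unfolding frakM_eq[OF part_subset[OF i]] sum_other_parts[OF i] by simp
  qed
  then have "(\<Sum>i\<in>I. frakM T (Xs i)) = of_int ((\<Sum>i\<in>I. \<Sum>j\<in>I - {i}. Ival T (Xs i) (Xs j)) -
      (\<Sum>i\<in>I. \<Sum>j\<in>I - {i}. \<Sum>a\<in>Xs i. \<Sum>b\<in>Xs j. ?w a b * ?f b))"
    by (simp add: sum_subtractf)
  \<comment> \<open>So far \<open>f\<close> is taken at the arrow of the other part. Exchanging the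
    roles of \<open>i\<close> and \<open>j\<close> turns this sum into the cross term of
    \<open>neg_Mval_partition\<close>.\<close>
  also have "(\<Sum>i\<in>I. \<Sum>j\<in>I - {i}. \<Sum>a\<in>Xs i. \<Sum>b\<in>Xs j. ?w a b * ?f b) =
      (\<Sum>i\<in>I. \<Sum>j\<in>I - {i}. \<Sum>a\<in>Xs j. \<Sum>b\<in>Xs i. ?w a b * ?f b)"
    by (rule sum_off_diagonal_swap[OF finite_I])
  also have "\<dots> = (\<Sum>i\<in>I. \<Sum>j\<in>I - {i}. \<Sum>a\<in>Xs i. \<Sum>b\<in>Xs j. ?w b a * ?f a)"
    by (intro sum.cong refl sum.swap)
  finally show ?thesis .
qed

text \<open>The cross term of \<open>neg_Mval_partition\<close> is eliminated by means of
  \<open>sum_frakM\<close>.\<close>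

lemma Mval_partition:
  "of_int (Mval T) = (\<Sum>i\<in>I. of_int (Mval (TX T v0 (Xs i)))) + (\<Sum>i\<in>I. frakM T (Xs i)) -
     (\<Sum>i\<in>I. \<Sum>j\<in>I - {i}. of_int (Ival T (Xs i) (Xs j)))"
proof -
  have "real_of_int (- Mval T) = of_int (\<Sum>i\<in>I. - Mval (TX T v0 (Xs i))) +
     of_int (\<Sum>i\<in>I. \<Sum>j\<in>I - {i}. \<Sum>a\<in>Xs i. \<Sum>b\<in>Xs j. path_weight T (gam T b a) * dfdec T a)"
    unfolding neg_Mval_partition by simp
  then show ?thesis
    unfolding sum_frakM by (simp add: sum_negf)
qed

text \<open>In each part the difference \<open>F - F_X\<close> in \<open>frakD\<close> or
  \<open>frakG\<close> replaces the \<open>F_X\<close> contributed by \<open>T_X\<close> by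
  \<open>F\<close>, and these values add up to \<open>Ftot T\<close>. What remains is
  \<open>Mval_partition\<close>.\<close>

lemma delta_and_genus_partition:
  defines "J \<equiv> (\<Sum>i\<in>I. \<Sum>j\<in>I - {i}. real_of_int (Ival T (Xs i) (Xs j)))"
  shows "delta_inv T = (\<Sum>i\<in>I. delta_inv (TX T v0 (Xs i))) - (\<Sum>i\<in>I. frakD T v0 (Xs i)) + J / 2"
    and "genus T - 1 = (\<Sum>i\<in>I. genus (TX T v0 (Xs i)) - 1) - (\<Sum>i\<in>I. frakG T v0 (Xs i)) + J / 2"
proof -
  let ?M = "\<lambda>i. real_of_int (Mval (TX T v0 (Xs i)))" and ?F = "\<lambda>i. \<Sum>a\<in>Xs i. real_of_int (Fval T a)"
  have F: "real_of_int (Ftot T) = (\<Sum>i\<in>I. ?F i)"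
    unfolding Ftot_def sum_parts by simp
  have FX: "real_of_int (Ftot (TX T v0 (Xs i))) = (\<Sum>a\<in>Xs i. real_of_int (FX T v0 (Xs i) a))"
    if "i \<in> I" for i
    using arrow_subset.Ftot_TX[OF part_arrow_subset[OF that]] by simp
  have "(\<Sum>i\<in>I. delta_inv (TX T v0 (Xs i))) - (\<Sum>i\<in>I. frakD T v0 (Xs i)) =
      (\<Sum>i\<in>I. (?F i - ?M i - frakM T (Xs i)) / 2)"
    unfolding sum_subtractf[symmetric] delta_inv_def frakD_def
    using FX by (intro sum.cong) (auto simp: sum_subtractf field_simps)
  also have "\<dots> = ((\<Sum>i\<in>I. ?F i) - (\<Sum>i\<in>I. ?M i) - (\<Sum>i\<in>I. frakM T (Xs i))) / 2"
    by (simp only: sum_divide_distrib[symmetric] sum_subtractf)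
  finally show "delta_inv T = (\<Sum>i\<in>I. delta_inv (TX T v0 (Xs i))) - (\<Sum>i\<in>I. frakD T v0 (Xs i)) + J / 2"
    unfolding delta_inv_def F Mval_partition J_def
    by argo
  have "(\<Sum>i\<in>I. genus (TX T v0 (Xs i)) - 1) - (\<Sum>i\<in>I. frakG T v0 (Xs i)) =
      (\<Sum>i\<in>I. (- ?F i - ?M i - frakM T (Xs i)) / 2)"
    unfolding sum_subtractf[symmetric] genus_def frakG_def
    using FX by (intro sum.cong) (auto simp: sum_subtractf field_simps)
  also have "\<dots> = (- (\<Sum>i\<in>I. ?F i) - (\<Sum>i\<in>I. ?M i) - (\<Sum>i\<in>I. frakM T (Xs i))) / 2"
    by (simp only: sum_divide_distrib[symmetric] sum_subtractf sum_negf)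
  finally show "genus T - 1 = (\<Sum>i\<in>I. genus (TX T v0 (Xs i)) - 1) - (\<Sum>i\<in>I. frakG T v0 (Xs i)) + J / 2"
    unfolding genus_def F Mval_partition J_def
    by argo
qed

end

lemma Ival_singletons:
  "(\<Sum>a\<in>arrsN T. \<Sum>b\<in>arrsN T - {a}. real_of_int (Ival T {a} {b})) = of_int (Ival T (arrsN T) (arrsN T))"
proof -
  have "Ival T {a} {b} = path_weight T (gam T a b) * dfdec T a * dfdec T b"
    if "a \<in> arrsN T" "b \<in> arrsN T - {a}" for a b
    using Ival_disjoint[of "{a}" "{b}"] that by auto
  then show ?thesis
    unfolding Ival_eq[OF subset_refl subset_refl] by simp
qed

end

theorem theorem4p19:
  fixes T :: "'c dtree" and v0 :: 'c and Xs :: "nat \<Rightarrow> 'c set" and n :: nat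
  assumes "decorated_pr_tree T v0"
    and "\<forall>i\<in>{1..n}. Xs i \<noteq> {}"
    and "\<forall>i\<in>{1..n}. \<forall>j\<in>{1..n}. i \<noteq> j \<longrightarrow> Xs i \<inter> Xs j = {}"
    and "(\<Union>i\<in>{1..n}. Xs i) = arrsN T"
  shows "(delta_inv T = (\<Sum>a\<in>arrsN T. delta_inv (TX T v0 {a})) - (\<Sum>a\<in>arrsN T. frakD T v0 {a})
            + of_int (Ival T (arrsN T) (arrsN T)) / 2) \<and>
    (delta_inv T = (\<Sum>i=1..n. delta_inv (TX T v0 (Xs i))) - (\<Sum>i=1..n. frakD T v0 (Xs i))
            + (\<Sum>(i, j)\<in>{(i, j). 1 \<le> i \<and> i < j \<and> j \<le> n}. of_int (Ival T (Xs i) (Xs j)))) \<and>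
    (genus T - 1 = (\<Sum>a\<in>arrsN T. genus (TX T v0 {a}) - 1) - (\<Sum>a\<in>arrsN T. frakG T v0 {a})
            + of_int (Ival T (arrsN T) (arrsN T)) / 2) \<and>
    (genus T - 1 = (\<Sum>i=1..n. genus (TX T v0 (Xs i)) - 1) - (\<Sum>i=1..n. frakG T v0 (Xs i))
            + (\<Sum>(i, j)\<in>{(i, j). 1 \<le> i \<and> i < j \<and> j \<le> n}. of_int (Ival T (Xs i) (Xs j))))"
proof -
  interpret pseudo_rooted_tree T v0
    using assms(1) by unfold_locales (auto simp: decorated_pr_tree_def decorated_tree_def)
  have sub: "Xs i \<subseteq> arrsN T" if "i \<in> {1..n}" for i
    using assms(4) that by blast
  have "Ival T (Xs i) (Xs j) = Ival T (Xs j) (Xs i)" if "i \<in> {1..n}" "j \<in> {1..n}" for i j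
  proof (cases "i = j")
    case False
    then show ?thesis
      using assms(3) sub that by (intro Ival_commute) auto
  qed simp
  \<comment> \<open>The double sum over ordered pairs counts each pair of distinct parts twice; this
    turns \<open>J / 2\<close> into the sum over \<open>i < j\<close>.\<close>
  then have half: "(\<Sum>i\<in>{1..n}. \<Sum>j\<in>{1..n} - {i}. real_of_int (Ival T (Xs i) (Xs j))) / 2 =
      (\<Sum>(i, j)\<in>{(i, j). 1 \<le> i \<and> i < j \<and> j \<le> n}. of_int (Ival T (Xs i) (Xs j)))"
    by (subst sum_off_diagonal_symmetric) auto
  note singletons = delta_and_genus_partition[of "arrsN T" "\<lambda>a. {a}", OF finite_arrsN]
  note parts = delta_and_genus_partition[of "{1..n}" Xs, OF finite_atLeastAtMost]
  show ?thesis
  proof (intro conjI)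
    show "delta_inv T = (\<Sum>a\<in>arrsN T. delta_inv (TX T v0 {a})) - (\<Sum>a\<in>arrsN T. frakD T v0 {a})
        + of_int (Ival T (arrsN T) (arrsN T)) / 2"
      using singletons(1) unfolding Ival_singletons by auto
    show "delta_inv T = (\<Sum>i=1..n. delta_inv (TX T v0 (Xs i))) - (\<Sum>i=1..n. frakD T v0 (Xs i))
        + (\<Sum>(i, j)\<in>{(i, j). 1 \<le> i \<and> i < j \<and> j \<le> n}. of_int (Ival T (Xs i) (Xs j)))"
      using parts(1) assms(2-4) unfolding half by blast
    show "genus T - 1 = (\<Sum>a\<in>arrsN T. genus (TX T v0 {a}) - 1) - (\<Sum>a\<in>arrsN T. frakG T v0 {a})
        + of_int (Ival T (arrsN T) (arrsN T)) / 2"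
      using singletons(2) unfolding Ival_singletons by auto
    show "genus T - 1 = (\<Sum>i=1..n. genus (TX T v0 (Xs i)) - 1) - (\<Sum>i=1..n. frakG T v0 (Xs i))
        + (\<Sum>(i, j)\<in>{(i, j). 1 \<le> i \<and> i < j \<and> j \<le> n}. of_int (Ival T (Xs i) (Xs j)))"
      using parts(2) assms(2-4) unfolding half by blast
  qed
qed

end
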